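(* Let $\delta>0$ and $4/3<q\le\infty$. Then there exists a constant $C_\delta>0$, independent of $\mu$, $\Omega$, $f_1$, $f_2$, such that for every integer $\mu\ge\mu_0$, every $\Omega\in L^q(\mathbb S^{2n-1})$ with $\int_{\mathbb S^{2n-1}}\Omega\,d\sigma=0$, and all Schwartz functions $f_1,f_2$ on $\mathbb R^n$, $$\|\mathcal L_\mu(f_1,f_2)\|_{BMO(\mathbb R^n)}\le C_\delta\,2^{\delta\mu}\,\|\Omega\|_{L^q(\mathbb S^{2n-1})}\,\|f_1\|_{L^\infty(\mathbb R^n)}\,\|f_2\|_{L^\infty(\mathbb R^n)} .$$
   Context: Let $n\ge1$ and write $\vec y=(y_1,y_2)\in(\mathbb R^n)^2$, $\vec\xi=(\xi_1,\xi_2)\in(\mathbb R^n)^2$. The Fourier transform is $\widehat f(\xi)=\int f(x)e^{-2\pi i\langle x,\xi\rangle}dx$. Fix a Schwartz function $\Phi$ on $(\mathbb R^n)^2$ whose Fourier transform is supported in $\{\vec\xi:1/2\le|\vec\xi|\le2\}$ and such that $\sum_{j\in\mathbb Z}\widehat{\Phi_j}(\vec\xi)=1$ for $\vec\xi\ne0$, where $\widehat{\Phi_j}(\vec\xi):=\widehat\Phi(\vec\xi/2^j)$. For $\Omega\in L^q(\mathbb S^{2n-1})$ with mean value zero let $K(\vec y):=\Omega(\vec y/|\vec y|)\,|\vec y|^{-2n}$ for $\vec y\ne0$, and for $\gamma,\mu\in\mathbb Z$ put $$K^\gamma(\vec y):=\widehat\Phi(2^\gamma\vec y)K(\vec y),\qquad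 K^\gamma_\mu:=\Phi_{\mu+\gamma}*K^\gamma,\qquad K_\mu:=\sum_{\gamma\in\mathbb Z}K_\mu^\gamma,$$ $$\mathcal L_\mu(f_1,f_2)(x):=\int_{(\mathbb R^n)^2}K_\mu(\vec y)f_1(x-y_1)f_2(x-y_2)\,d\vec y=\sum_{\gamma\in\mathbb Z}\int_{(\mathbb R^n)^2}K^\gamma_\mu(\vec y)f_1(x-y_1)f_2(x-y_2)\,d\vec y .$$ (The integral against $K_\mu$ is understood as the sum over $\gamma$ on the right.) The number $\mu_0$ is a fixed positive integer for which, for the given $q>4/3$, there are constants $\epsilon_1,C_1>0$ such that for all integers $\mu\ge\mu_0$, all mean-zero $\Omega\in L^q(\mathbb S^{2n-1})$ and all Schwartz $f_1,f_2$: $\|\mathcal L_\mu(f_1,f_2)\|_{L^1(\mathbb R^n)}\le C_1 2^{-\epsilon_1\mu}\|\Omega\|_{L^q(\mathbb S^{2n-1})}\|f_1\|_{L^2(\mathbb R^n)}\|f_2\|_{L^2(\mathbb R^n)}$ (the existence of such a $\mu_0$ is known from earlier work). The $BMO$ norm is $\|f\|_{BMO(\mathbb R^n)}:=\sup_Q\inf_{a\in\mathbb C}\frac1{|Q|}\int_Q|f(x)-a|\,dx$, the supremum being over all cubes $Q$ in $\mathbb R^n$. *)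

theory Defs
  imports "HOL-Analysis.Analysis" "HOL-Probability.Essential_Supremum"
begin

section \<open>Schwartz functions and the Fourier transform\<close>

fun iter_deriv :: "'a::euclidean_space list \<Rightarrow> ('a \<Rightarrow> complex) \<Rightarrow> 'a \<Rightarrow> complex" where
  "iter_deriv [] f = f"
| "iter_deriv (b # bs) f = (\<lambda>x. frechet_derivative (iter_deriv bs f) (at x) b)"

text \<open>Iterated partial derivatives along basis vectors, in any order. Requiring each of them to be
  (Frechet) differentiable everywhere is smoothness, and the weights \<open>\<bar>x\<bar>^k\<close> for all \<open>k\<close> are
  equivalent to all monomial weights.\<close>

definition schwartz :: "('a::euclidean_space \<Rightarrow> complex) \<Rightarrow> bool" where
  "schwartz f \<longleftrightarrow>
     (\<forall>bs. set bs \<subseteq> Basis \<longrightarrow>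
        (\<forall>x. iter_deriv bs f differentiable (at x)) \<and>
        (\<forall>k::nat. bounded (range (\<lambda>x. norm x ^ k *\<^sub>R iter_deriv bs f x))))"

definition fourier :: "('a::euclidean_space \<Rightarrow> complex) \<Rightarrow> 'a \<Rightarrow> complex" where
  "fourier f \<xi> = (LINT x|lborel. f x * exp (- 2 * pi * \<i> * complex_of_real (x \<bullet> \<xi>)))"

definition convolution ::
  "('a::euclidean_space \<Rightarrow> complex) \<Rightarrow> ('a \<Rightarrow> complex) \<Rightarrow> 'a \<Rightarrow> complex" where
  "convolution f g y = (LINT z|lborel. f (y - z) * g z)"

text \<open>The \<open>L\<^sup>1\<close>-normalised dilate, i.e. the function whose Fourier transform is
  \<open>\<xi> \<mapsto> fourier \<Phi> (\<xi> / 2^j)\<close>; see \<open>fourier_dilate\<close> below.\<close>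

definition dilate :: "int \<Rightarrow> ('a::euclidean_space \<Rightarrow> complex) \<Rightarrow> 'a \<Rightarrow> complex" where
  "dilate j \<Phi> y = (2 powi j) ^ DIM('a) * \<Phi> ((2 powi j) *\<^sub>R y)"

lemma fourier_dilate:
  fixes \<Phi> :: "'a::euclidean_space \<Rightarrow> complex"
  assumes [measurable]: "\<Phi> \<in> borel_measurable borel"
  shows "fourier (dilate j \<Phi>) \<xi> = fourier \<Phi> (\<xi> /\<^sub>R 2 powi j)"
proof -
  define c :: real where "c = 2 powi j"
  have c: "c > 0" by (simp add: c_def)
  have cc: "complex_of_real c = 2 powi j" by (simp add: c_def)
  have inner: "(c *\<^sub>R x) \<bullet> (\<xi> /\<^sub>R c) = x \<bullet> \<xi>" for x
    using c by simp
  let ?F = "\<lambda>x. \<Phi> x * exp (- 2 * pi * \<i> * complex_of_real (x \<bullet> (\<xi> /\<^sub>R c)))"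
  have "fourier \<Phi> (\<xi> /\<^sub>R c) = (LINT x|lborel. ?F x)"
    by (simp add: fourier_def)
  also have "\<dots> = (LINT x|density (distr lborel borel (\<lambda>x. 0 + c *\<^sub>R x)) (\<lambda>_. \<bar>c\<bar> ^ DIM('a)). ?F x)"
    using lborel_affine[of c "0::'a"] c by simp
  also have "\<dots> = (LINT x|lborel. \<bar>c\<bar> ^ DIM('a) *\<^sub>R ?F (c *\<^sub>R x))"
    by (subst integral_density) (use c in \<open>auto simp: integral_distr\<close>)
  also have "\<dots> = fourier (dilate j \<Phi>) \<xi>"
    unfolding fourier_def dilate_def
    by (rule Bochner_Integration.integral_cong)
       (use c in \<open>auto simp: cc[symmetric] c_def[symmetric] scaleR_conv_of_real inner
          simp del: inner_scaleR_left inner_scaleR_right\<close>)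
  finally show ?thesis by (simp add: c_def)
qed


section \<open>Surface measure on the unit sphere\<close>

text \<open>Cone measure: \<open>\<sigma>(A) = d \<cdot> \<lambda>{r \<theta> | 0 < r \<le> 1, \<theta> \<in> A}\<close> in dimension \<open>d\<close>. This is the usual
  surface measure, characterised by \<open>dx = r^(d-1) dr d\<sigma>(\<theta>)\<close>. Here \<open>sgn y = y / \<bar>y\<bar>\<close>.\<close>

definition sphere_measure :: "'a::euclidean_space measure" where
  "sphere_measure =
     scale_measure (of_nat DIM('a))
       (distr (restrict_space lborel (cball 0 1 - {0})) (restrict_space borel (sphere 0 1)) sgn)"

lemma emeasure_sphere_measure:
  fixes A :: "'a::euclidean_space set"
  assumes "A \<in> sets borel" "A \<subseteq> sphere 0 1"
  shows "emeasure sphere_measure A =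
           of_nat DIM('a) * emeasure lborel {r *\<^sub>R \<theta> | r \<theta>. 0 < r \<and> r \<le> 1 \<and> \<theta> \<in> A}"
proof -
  let ?B = "cball (0::'a) 1 - {0}"
  have m: "sgn \<in> restrict_space lborel ?B \<rightarrow>\<^sub>M restrict_space borel (sphere (0::'a) 1)"
    by (rule measurable_restrict_space2)
       (auto simp: norm_sgn space_restrict_space sgn_div_norm[abs_def] intro!: measurable_restrict_space1)
  have A: "A \<in> sets (restrict_space borel (sphere (0::'a) 1))"
    using assms by (auto simp: sets_restrict_space)
  have eq: "sgn -` A \<inter> ?B = {r *\<^sub>R \<theta> | r \<theta>. 0 < r \<and> r \<le> 1 \<and> \<theta> \<in> A}"
  proof (intro equalityI subsetI)
    fix x assume x: "x \<in> sgn -` A \<inter> ?B"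
    then have "x = norm x *\<^sub>R sgn x" by (simp add: sgn_div_norm)
    with x show "x \<in> {r *\<^sub>R \<theta> | r \<theta>. 0 < r \<and> r \<le> 1 \<and> \<theta> \<in> A}"
      by (intro CollectI exI[of _ "norm x"] exI[of _ "sgn x"]) auto
  next
    fix x assume "x \<in> {r *\<^sub>R \<theta> | r \<theta>. 0 < r \<and> r \<le> 1 \<and> \<theta> \<in> A}"
    then obtain r \<theta> where r: "x = r *\<^sub>R \<theta>" "0 < r" "r \<le> 1" "\<theta> \<in> A" by auto
    with assms have "norm \<theta> = 1" by auto
    with r show "x \<in> sgn -` A \<inter> ?B" by (auto simp: sgn_div_norm)
  qed
  have "emeasure (distr (restrict_space lborel ?B) (restrict_space borel (sphere 0 1)) sgn) A
          = emeasure lborel (sgn -` A \<inter> ?B)"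
    by (simp add: emeasure_distr[OF m A] space_restrict_space)
       (subst emeasure_restrict_space, auto)
  then show ?thesis
    unfolding sphere_measure_def eq by simp
qed


section \<open>Lebesgue and BMO norms\<close>

text \<open>Norms are extended-real valued, so that a norm bound is never satisfied by a default value.
  Meaningful for \<open>1 \<le> p \<le> \<infinity>\<close>.\<close>

definition Lp_norm :: "'a measure \<Rightarrow> ennreal \<Rightarrow> ('a \<Rightarrow> complex) \<Rightarrow> ennreal" where
  "Lp_norm M p f =
     (if p = \<infinity> then esssup M (\<lambda>x. ennreal (norm (f x)))
      else let I = (\<integral>\<^sup>+x. ennreal (norm (f x) powr enn2real p) \<partial>M)
           in if I = \<infinity> then \<infinity> else ennreal (enn2real I powr (1 / enn2real p)))"

definition Lp_space :: "'a measure \<Rightarrow> ennreal \<Rightarrow> ('a \<Rightarrow> complex) set" where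
  "Lp_space M p = {f \<in> borel_measurable M. Lp_norm M p f < \<infinity>}"

definition cubes :: "(real^'n) set set" where
  "cubes = {cbox a (a + (\<chi> i. l)) | a l. 0 < l}"

definition BMO_norm :: "(real^'n \<Rightarrow> complex) \<Rightarrow> ennreal" where
  "BMO_norm f =
     (SUP Q\<in>cubes. INF a::complex.
        (\<integral>\<^sup>+x\<in>Q. ennreal (norm (f x - a)) \<partial>lborel) / emeasure lborel Q)"


section \<open>The frequency-localised rough bilinear operators\<close>

definition rough_kernel :: "('a::euclidean_space \<Rightarrow> complex) \<Rightarrow> 'a \<Rightarrow> complex" where
  "rough_kernel \<Omega> y = (if y = 0 then 0 else \<Omega> (y /\<^sub>R norm y) / norm y ^ DIM('a))"

definition kernel_annulus ::
  "('a::euclidean_space \<Rightarrow> complex) \<Rightarrow> ('a \<Rightarrow> complex) \<Rightarrow> int \<Rightarrow> 'a \<Rightarrow> complex" where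
  "kernel_annulus \<Phi> \<Omega> \<gamma> y = fourier \<Phi> ((2 powi \<gamma>) *\<^sub>R y) * rough_kernel \<Omega> y"

definition kernel_piece ::
  "('a::euclidean_space \<Rightarrow> complex) \<Rightarrow> ('a \<Rightarrow> complex) \<Rightarrow> int \<Rightarrow> int \<Rightarrow> 'a \<Rightarrow> complex" where
  "kernel_piece \<Phi> \<Omega> \<mu> \<gamma> = convolution (dilate (\<mu> + \<gamma>) \<Phi>) (kernel_annulus \<Phi> \<Omega> \<gamma>)"

text \<open>\<open>(\<real>\<^sup>n)\<^sup>2\<close> is the product type, whose norm is the Euclidean one and whose dimension is \<open>2 n\<close>.\<close>

definition bilinear_op ::
  "((real^'n) \<times> (real^'n) \<Rightarrow> complex) \<Rightarrow> ((real^'n) \<times> (real^'n) \<Rightarrow> complex) \<Rightarrow> int \<Rightarrow>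
   (real^'n \<Rightarrow> complex) \<Rightarrow> (real^'n \<Rightarrow> complex) \<Rightarrow> real^'n \<Rightarrow> complex" where
  "bilinear_op \<Phi> \<Omega> \<mu> f1 f2 x =
     (\<Sum>\<^sub>\<infinity>\<gamma>\<in>UNIV. LINT y|lborel. kernel_piece \<Phi> \<Omega> \<mu> \<gamma> y * f1 (x - fst y) * f2 (x - snd y))"

end

theory Submission
  imports Defs
begin

text \<open>
  Fix a cube \<open>Q\<close> with corner \<open>c\<close> and side \<open>l\<close>, and let \<open>K\<^sub>\<gamma>\<close> be the kernel piece at scale \<open>\<gamma>\<close>. It lives on
  \<open>\<bar>y\<bar> \<approx> 2^-\<gamma>\<close>, it oscillates at frequency \<open>2^(\<mu>+\<gamma>)\<close>, and its integral vanishes. Up to the factor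
  \<open>\<parallel>\<Omega>\<parallel>\<^sub>q\<close>, these facts are recorded quantitatively by the predicate \<open>localized_kernel\<close>: an \<open>L\<^sup>1\<close> bound, a bound
  for the first moment (gain \<open>2^-\<gamma>\<close>), an \<open>L\<^sup>1\<close> modulus of continuity (loss \<open>2^(\<mu>+\<gamma>)\<close>) and a
  supremum bound. They hold because \<open>K\<^sub>\<gamma>\<close> is the convolution of a dilated Schwartz function with a function
  whose \<open>L\<^sup>1\<close> norm is controlled uniformly in \<open>\<gamma>\<close> by \<open>\<parallel>\<Omega>\<parallel>\<^sub>1\<close>, hence by \<open>\<parallel>\<Omega>\<parallel>\<^sub>q\<close>
  (\<open>kernel_piece_localized\<close>).

  The sum over \<open>\<gamma>\<close> is compared with the size of \<open>Q\<close>. Write \<open>F = f1 \<otimes> f2\<close>, so that the operator at \<open>x\<close> is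
  \<open>\<Sum>\<^sub>\<gamma> (F * K\<^sub>\<gamma>)(x, x)\<close>, and let \<open>E\<close> be the Gaussian on the product space centred at \<open>(c, c)\<close> with
  width \<open>l\<close>; it is a tensor square, so \<open>F E\<close> is again a tensor product of Schwartz functions. For
  \<open>x \<in> Q\<close> and \<open>p = (x, x)\<close>, the value \<open>E p\<close> is bounded below, and the comparison lemma
  \<open>scale_comparison\<close> treats \<open>(F * K\<^sub>\<gamma>) p - ((F E) * K\<^sub>\<gamma>) p / E p\<close> in three regimes.

  \<^item> \<open>2^-\<gamma> < l\<close>: the multiplier \<open>1 - E(p - y) / E p\<close> is \<open>O(\<bar>y\<bar> / l)\<close>, so the first moment gives
    \<open>O(2^-\<gamma> / l)\<close>, which is summable. It is this regime that makes a Gaussian as good as a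
    compactly supported cutoff equal to \<open>1\<close> near \<open>Q\<close>.
  \<^item> \<open>l \<le> 2^-\<gamma> < 2^\<mu> l\<close>: there are \<open>\<mu>\<close> such scales, each contributing \<open>O(1)\<close>. This is the only source of
    growth in \<open>\<mu>\<close>.
  \<^item> \<open>2^\<mu> l \<le> 2^-\<gamma>\<close>: the term \<open>F * K\<^sub>\<gamma>\<close> differs from its value at \<open>(c, c)\<close> by \<open>O(2^(\<mu>+\<gamma>) l)\<close>, and
    the term with \<open>F E\<close> is small because \<open>\<parallel>E\<parallel>\<^sub>1 \<approx> l^(2n)\<close>.

  Thus, on \<open>Q\<close> and up to one additive constant (the sum of the values at \<open>(c, c)\<close>), the operator
  applied to \<open>(f1, f2)\<close> is a bounded multiple of the operator applied to \<open>f1\<close> and \<open>f2\<close> times Gaussians, with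
  an error \<open>O(\<mu> + 3)\<close> (\<open>bilinear_op_cube_approximation\<close>). The assumed \<open>L\<^sup>2 \<times> L\<^sup>2 \<rightarrow> L\<^sup>1\<close> estimate
  bounds the average of the former over \<open>Q\<close>, since the Gaussian has squared \<open>L\<^sup>2\<close> norm \<open>O(l^n)\<close>; and
  \<open>\<mu> + 3\<close> is absorbed by \<open>2^(\<delta> \<mu>)\<close>.
\<close>

section \<open>Translations, dilations and convolutions on Euclidean space\<close>

lemma nn_integral_lborel_affine:
  fixes f :: "'a::euclidean_space \<Rightarrow> ennreal"
  assumes [measurable]: "f \<in> borel_measurable borel" and c: "c \<noteq> 0"
  shows "(\<integral>\<^sup>+x. f x \<partial>lborel) = ennreal (\<bar>c\<bar> ^ DIM('a)) * (\<integral>\<^sup>+x. f (t + c *\<^sub>R x) \<partial>lborel)"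
  by (subst lborel_affine[OF c, of t])
     (simp add: nn_integral_density nn_integral_distr nn_integral_cmult)

lemma nn_integral_lborel_reflect:
  fixes f :: "'a::euclidean_space \<Rightarrow> ennreal"
  assumes "f \<in> borel_measurable borel"
  shows "(\<integral>\<^sup>+x. f (t - x) \<partial>lborel) = (\<integral>\<^sup>+x. f x \<partial>lborel)"
  using nn_integral_lborel_affine[OF assms, of "-1" t] by simp

lemma nn_integral_lborel_shift:
  fixes f :: "'a::euclidean_space \<Rightarrow> ennreal"
  assumes "f \<in> borel_measurable borel"
  shows "(\<integral>\<^sup>+x. f (x - t) \<partial>lborel) = (\<integral>\<^sup>+x. f x \<partial>lborel)"
  using nn_integral_lborel_affine[OF assms, of 1 "-t"] by simp

lemma lborel_reflect: "distr lborel borel (\<lambda>x. t - x) = (lborel :: 'a::euclidean_space measure)"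
  using lborel_affine[of "-1" t] by (simp add: density_1)

lemma lborel_shift: "distr lborel borel (\<lambda>x. x - t) = (lborel :: 'a::euclidean_space measure)"
  using lborel_affine[of 1 "-t"] by (simp add: density_1)

lemma integral_lborel_shift:
  fixes f :: "'a::euclidean_space \<Rightarrow> complex"
  assumes [measurable]: "f \<in> borel_measurable borel"
  shows "(LINT x|lborel. f (x - t)) = (LINT x|lborel. f x)"
  by (subst (2) lborel_shift[symmetric, of t]) (simp add: integral_distr)

lemma integrable_lborel_reflect:
  fixes f :: "'a::euclidean_space \<Rightarrow> complex"
  assumes "integrable lborel f"
  shows "integrable lborel (\<lambda>x. f (t - x))"
proof -
  have [measurable]: "f \<in> borel_measurable borel" using assms by auto
  show ?thesis
    using assms by (subst (asm) lborel_reflect[symmetric, of t]) (simp add: integrable_distr_eq)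
qed

lemma convolution_commute:
  fixes f g :: "'a::euclidean_space \<Rightarrow> complex"
  assumes [measurable]: "f \<in> borel_measurable borel" "g \<in> borel_measurable borel"
  shows "convolution f g y = convolution g f y"
  unfolding convolution_def
  by (subst (1) lborel_reflect[symmetric, of y]) (simp add: integral_distr mult.commute)

lemma borel_measurable_convolution [measurable]:
  fixes f g :: "'a::euclidean_space \<Rightarrow> complex"
  assumes [measurable]: "f \<in> borel_measurable borel" "g \<in> borel_measurable borel"
  shows "convolution f g \<in> borel_measurable borel"
  unfolding convolution_def[abs_def] by measurable

text \<open>Tonelli for nonnegative functions, which every \<open>L\<^sup>1\<close> and first-moment
  estimate for a convolution reduces to.\<close>

lemma nn_integral_convolution:
  fixes a b :: "'a::euclidean_space \<Rightarrow> ennreal"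
  assumes [measurable]: "a \<in> borel_measurable borel" "b \<in> borel_measurable borel"
  shows "(\<integral>\<^sup>+y. (\<integral>\<^sup>+z. a (y - z) * b z \<partial>lborel) \<partial>lborel)
           = (\<integral>\<^sup>+y. a y \<partial>lborel) * (\<integral>\<^sup>+z. b z \<partial>lborel)"
proof -
  have "(\<integral>\<^sup>+y. (\<integral>\<^sup>+z. a (y - z) * b z \<partial>lborel) \<partial>lborel)
          = (\<integral>\<^sup>+z. (\<integral>\<^sup>+y. a (y - z) * b z \<partial>lborel) \<partial>lborel)"
    by (rule lborel_pair.Fubini') measurable
  also have "\<dots> = (\<integral>\<^sup>+z. (\<integral>\<^sup>+y. a y \<partial>lborel) * b z \<partial>lborel)"
    by (simp add: nn_integral_multc nn_integral_lborel_shift)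
  also have "\<dots> = (\<integral>\<^sup>+y. a y \<partial>lborel) * (\<integral>\<^sup>+z. b z \<partial>lborel)"
    by (simp add: nn_integral_cmult)
  finally show ?thesis .
qed

text \<open>If the convolution integral diverges, its value is \<open>0\<close> and the bound is trivial.\<close>

lemma norm_convolution_le_nn:
  fixes f g :: "'a::euclidean_space \<Rightarrow> complex"
  shows "ennreal (norm (convolution f g y))
           \<le> (\<integral>\<^sup>+z. ennreal (norm (f (y - z))) * ennreal (norm (g z)) \<partial>lborel)"
proof (cases "integrable lborel (\<lambda>z. f (y - z) * g z)")
  case True
  show ?thesis
    using integral_norm_bound_ennreal[OF True]
    by (simp add: convolution_def norm_mult ennreal_mult')
next
  case False
  then show ?thesis by (simp add: convolution_def not_integrable_integral_eq)
qed

lemma nn_integral_norm_convolution_le: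
  fixes f g :: "'a::euclidean_space \<Rightarrow> complex"
  assumes [measurable]: "f \<in> borel_measurable borel" "g \<in> borel_measurable borel"
  shows "(\<integral>\<^sup>+y. ennreal (norm (convolution f g y)) \<partial>lborel)
           \<le> (\<integral>\<^sup>+y. ennreal (norm (f y)) \<partial>lborel) * (\<integral>\<^sup>+y. ennreal (norm (g y)) \<partial>lborel)"
proof -
  have "(\<integral>\<^sup>+y. ennreal (norm (convolution f g y)) \<partial>lborel)
          \<le> (\<integral>\<^sup>+y. (\<integral>\<^sup>+z. ennreal (norm (f (y - z))) * ennreal (norm (g z)) \<partial>lborel) \<partial>lborel)"
    by (intro nn_integral_mono norm_convolution_le_nn)
  also have "\<dots> = (\<integral>\<^sup>+y. ennreal (norm (f y)) \<partial>lborel) * (\<integral>\<^sup>+y. ennreal (norm (g y)) \<partial>lborel)"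
    by (rule nn_integral_convolution) measurable
  finally show ?thesis .
qed

text \<open>Split \<open>\<bar>y\<bar> \<le> \<bar>y - z\<bar> + \<bar>z\<bar>\<close> inside the
  convolution integral.\<close>

lemma nn_integral_moment_convolution_le:
  fixes f g :: "'a::euclidean_space \<Rightarrow> complex"
  assumes [measurable]: "f \<in> borel_measurable borel" "g \<in> borel_measurable borel"
  shows "(\<integral>\<^sup>+y. ennreal (norm y * norm (convolution f g y)) \<partial>lborel)
           \<le> (\<integral>\<^sup>+y. ennreal (norm y * norm (f y)) \<partial>lborel) * (\<integral>\<^sup>+y. ennreal (norm (g y)) \<partial>lborel)
             + (\<integral>\<^sup>+y. ennreal (norm (f y)) \<partial>lborel) * (\<integral>\<^sup>+y. ennreal (norm y * norm (g y)) \<partial>lborel)"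
proof -
  have 1: "ennreal (norm y * norm (convolution f g y))
          \<le> (\<integral>\<^sup>+z. ennreal (norm (y - z) * norm (f (y - z))) * ennreal (norm (g z)) \<partial>lborel)
            + (\<integral>\<^sup>+z. ennreal (norm (f (y - z))) * ennreal (norm z * norm (g z)) \<partial>lborel)" for y
  proof -
    have "ennreal (norm y * norm (convolution f g y))
          \<le> ennreal (norm y) * (\<integral>\<^sup>+z. ennreal (norm (f (y - z))) * ennreal (norm (g z)) \<partial>lborel)"
      by (simp add: ennreal_mult' mult_left_mono norm_convolution_le_nn)
    also have "\<dots> = (\<integral>\<^sup>+z. ennreal (norm y) * (ennreal (norm (f (y - z))) * ennreal (norm (g z))) \<partial>lborel)"
      by (rule nn_integral_cmult[symmetric]) measurable
    also have "\<dots> \<le> (\<integral>\<^sup>+z. ennreal (norm (y - z) * norm (f (y - z))) * ennreal (norm (g z))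
                 + ennreal (norm (f (y - z))) * ennreal (norm z * norm (g z)) \<partial>lborel)"
    proof (rule nn_integral_mono)
      fix z
      have "norm y \<le> norm (y - z) + norm z" by (metis diff_add_cancel norm_triangle_ineq)
      then have "norm y * (norm (f (y - z)) * norm (g z)) 
                  \<le> (norm (y - z) + norm z) * (norm (f (y - z)) * norm (g z))"
        by (intro mult_right_mono) auto
      also have "\<dots> = norm (y - z) * norm (f (y - z)) * norm (g z) 
                      + norm (f (y - z)) * (norm z * norm (g z))"
        by (simp add: algebra_simps)
      finally show "ennreal (norm y) * (ennreal (norm (f (y - z))) * ennreal (norm (g z)))
              \<le> ennreal (norm (y - z) * norm (f (y - z))) * ennreal (norm (g z))
                 + ennreal (norm (f (y - z))) * ennreal (norm z * norm (g z))"
        by (simp add: ennreal_mult'[symmetric] ennreal_plus[symmetric] del: ennreal_plus)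
    qed
    also have "\<dots> = (\<integral>\<^sup>+z. ennreal (norm (y - z) * norm (f (y - z))) * ennreal (norm (g z)) \<partial>lborel)
            + (\<integral>\<^sup>+z. ennreal (norm (f (y - z))) * ennreal (norm z * norm (g z)) \<partial>lborel)"
      by (rule nn_integral_add) measurable
    finally show ?thesis .
  qed
  have "(\<integral>\<^sup>+y. ennreal (norm y * norm (convolution f g y)) \<partial>lborel)
        \<le> (\<integral>\<^sup>+y. (\<integral>\<^sup>+z. ennreal (norm (y - z) * norm (f (y - z))) * ennreal (norm (g z)) \<partial>lborel)
            + (\<integral>\<^sup>+z. ennreal (norm (f (y - z))) * ennreal (norm z * norm (g z)) \<partial>lborel) \<partial>lborel)"
    by (intro nn_integral_mono 1)
  also have "\<dots> = (\<integral>\<^sup>+y. (\<integral>\<^sup>+z. ennreal (norm (y - z) * norm (f (y - z))) * ennreal (norm (g z)) \<partial>lborel) \<partial>lborel)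
            + (\<integral>\<^sup>+y. (\<integral>\<^sup>+z. ennreal (norm (f (y - z))) * ennreal (norm z * norm (g z)) \<partial>lborel) \<partial>lborel)"
    by (rule nn_integral_add) measurable
  also have "\<dots> = (\<integral>\<^sup>+y. ennreal (norm y * norm (f y)) \<partial>lborel) * (\<integral>\<^sup>+y. ennreal (norm (g y)) \<partial>lborel)
             + (\<integral>\<^sup>+y. ennreal (norm (f y)) \<partial>lborel) * (\<integral>\<^sup>+y. ennreal (norm y * norm (g y)) \<partial>lborel)"
    using nn_integral_convolution[of "\<lambda>y. ennreal (norm y * norm (f y))" "\<lambda>y. ennreal (norm (g y))"]
      nn_integral_convolution[of "\<lambda>y. ennreal (norm (f y))" "\<lambda>y. ennreal (norm y * norm (g y))"]
    by simp
  finally show ?thesis .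
qed

lemma norm_convolution_le_sup:
  fixes f g :: "'a::euclidean_space \<Rightarrow> complex"
  assumes bd: "\<And>z. norm (f z) \<le> M" and g: "integrable lborel g"
  shows "norm (convolution f g y) \<le> M * (LINT z|lborel. norm (g z))"
proof -
  have M: "0 \<le> M" using bd[of undefined] norm_ge_zero by (rule order_trans[rotated])
  have "norm (convolution f g y) \<le> (LINT z|lborel. norm (f (y - z) * g z))"
    unfolding convolution_def by (rule integral_norm_bound)
  also have "\<dots> \<le> (LINT z|lborel. M * norm (g z))"
    by (rule integral_mono') (use bd M g in \<open>auto simp: norm_mult intro!: mult_right_mono\<close>)
  finally show ?thesis using M by simp
qed

lemma integrable_bounded_mult:
  fixes f g :: "'a::euclidean_space \<Rightarrow> complex"
  assumes [measurable]: "f \<in> borel_measurable borel"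
    and bd: "\<And>z. norm (f z) \<le> M" and g: "integrable lborel g"
  shows "integrable lborel (\<lambda>z. f z * g z)"
proof (rule Bochner_Integration.integrable_bound)
  show "integrable lborel (\<lambda>z. M * norm (g z))" using g by auto
  show "(\<lambda>z. f z * g z) \<in> borel_measurable lborel" using g by auto
  have "norm (f z * g z) \<le> norm (M * norm (g z))" for z
    using bd[of z] mult_right_mono[of "norm (f z)" "\<bar>M\<bar>" "norm (g z)"] by (auto simp: norm_mult abs_mult)
  then show "AE z in lborel. norm (f z * g z) \<le> norm (M * norm (g z))" by simp
qed

lemma integral_convolution:
  fixes f g :: "'a::euclidean_space \<Rightarrow> complex"
  assumes f: "integrable lborel f" and g: "integrable lborel g"
  shows "(LINT y|lborel. convolution f g y) = (LINT y|lborel. f y) * (LINT y|lborel. g y)"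
proof -
  have [measurable]: "f \<in> borel_measurable borel" "g \<in> borel_measurable borel"
    using f g by auto
  have fin: "(\<integral>\<^sup>+y. ennreal (norm (f y)) \<partial>lborel) < \<infinity>" "(\<integral>\<^sup>+y. ennreal (norm (g y)) \<partial>lborel) < \<infinity>"
    using f g by (auto simp: integrable_iff_bounded)
  have "integrable (lborel \<Otimes>\<^sub>M lborel) (\<lambda>(y, z). f (y - z) * g z)"
  proof (subst integrable_iff_bounded, safe)
    show "(\<lambda>(y, z). f (y - z) * g z) \<in> borel_measurable (lborel \<Otimes>\<^sub>M lborel)" by measurable
    have "(\<integral>\<^sup>+p. ennreal (norm (case p of (y, z) \<Rightarrow> f (y - z) * g z)) \<partial>(lborel \<Otimes>\<^sub>M lborel))
      = (\<integral>\<^sup>+y. (\<integral>\<^sup>+z. ennreal (norm (f (y - z))) * ennreal (norm (g z)) \<partial>lborel) \<partial>lborel)"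
      by (subst lborel.nn_integral_fst[symmetric]) (auto simp: norm_mult ennreal_mult')
    also have "\<dots> < \<infinity>"
      using fin by (subst nn_integral_convolution) (auto simp: ennreal_mult_less_top)
    finally show "(\<integral>\<^sup>+p. ennreal (norm (case p of (y, z) \<Rightarrow> f (y - z) * g z)) \<partial>(lborel \<Otimes>\<^sub>M lborel)) < \<infinity>" .
  qed
  then have "(LINT z|lborel. LINT y|lborel. f (y - z) * g z) = (LINT y|lborel. LINT z|lborel. f (y - z) * g z)"
    by (rule lborel_pair.Fubini_integral)
  then have "(LINT y|lborel. convolution f g y) = (LINT z|lborel. LINT y|lborel. f (y - z) * g z)"
    by (simp add: convolution_def)
  also have "\<dots> = (LINT z|lborel. (LINT y|lborel. f y) * g z)"
    by (simp add: integral_lborel_shift)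
  finally show ?thesis by simp
qed

section \<open>An integrable weight of polynomial decay\<close>

lemma nn_integral_inverse_1_plus_square:
  "(\<integral>\<^sup>+x. ennreal (inverse (1 + x^2)) \<partial>lborel) < \<infinity>"
proof -
  let ?g = "\<lambda>x::real. ennreal (inverse (1 + x^2)) * indicator {0..} x"
  have half: "(\<integral>\<^sup>+x. ?g x \<partial>lborel) = ennreal (pi / 2 - arctan 0)"
  proof (rule nn_integral_FTC_atLeast)
    show "DERIV arctan x :> inverse (1 + x^2)" for x by (rule DERIV_arctan)
  qed (auto intro: tendsto_arctan_at_top)
  have "(\<integral>\<^sup>+x. ennreal (inverse (1 + x^2)) \<partial>lborel) \<le> (\<integral>\<^sup>+x. ?g x + ?g (0 - x) \<partial>lborel)"
    by (intro nn_integral_mono) (auto split: split_indicator)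
  also have "\<dots> = (\<integral>\<^sup>+x. ?g x \<partial>lborel) + (\<integral>\<^sup>+x. ?g (0 - x) \<partial>lborel)"
    by (rule nn_integral_add) measurable
  also have "(\<integral>\<^sup>+x. ?g (0 - x) \<partial>lborel) = (\<integral>\<^sup>+x. ?g x \<partial>lborel)"
    by (rule nn_integral_lborel_reflect) measurable
  finally show ?thesis
    unfolding half by (rule le_less_trans) (simp add: ennreal_plus[symmetric] del: ennreal_plus)
qed

text \<open>With the dimension as exponent, the weight is dominated by the product of the one-dimensional
  weights \<open>1 / (1 + x\<^sub>b\<^sup>2)\<close> over the coordinates, whence its
  integrability.\<close>

definition decay_weight :: "'a::euclidean_space \<Rightarrow> real" where
  "decay_weight x = inverse ((1 + (norm x)\<^sup>2) ^ DIM('a))"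

lemma decay_weight_pos: "0 < decay_weight x"
  unfolding decay_weight_def by (simp add: add_pos_nonneg)

lemma borel_measurable_decay_weight [measurable]: "decay_weight \<in> borel_measurable borel"
  unfolding decay_weight_def[abs_def] by measurable

lemma integrable_decay_weight: "integrable lborel (decay_weight :: 'a::euclidean_space \<Rightarrow> real)"
proof (subst integrable_iff_bounded, safe)
  have "ennreal (norm (decay_weight x)) \<le> (\<Prod>b\<in>Basis. ennreal (inverse (1 + (x \<bullet> b)^2)))" for x :: 'a
  proof -
    have "(\<Prod>b\<in>(Basis::'a set). 1 + (x \<bullet> b)^2) \<le> (\<Prod>b\<in>(Basis::'a set). 1 + (norm x)^2)"
    proof (rule prod_mono, safe)
      fix b :: 'a assume b: "b \<in> Basis"
      show "0 \<le> 1 + (x \<bullet> b)\<^sup>2" by simp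
      show "1 + (x \<bullet> b)\<^sup>2 \<le> 1 + (norm x)\<^sup>2"
        using power_mono[OF Basis_le_norm[OF b, of x], of 2] by simp
    qed
    then have "decay_weight x \<le> inverse (\<Prod>b\<in>(Basis::'a set). 1 + (x \<bullet> b)^2)"
      unfolding decay_weight_def
      by (intro le_imp_inverse_le) (auto intro!: prod_pos add_pos_nonneg)
    also have "\<dots> = (\<Prod>b\<in>(Basis::'a set). inverse (1 + (x \<bullet> b)^2))"
      by (simp add: prod_inversef[symmetric] comp_def)
    finally show ?thesis
      using decay_weight_pos[of x] by (simp add: prod_ennreal ennreal_leI less_imp_le)
  qed
  then have "(\<integral>\<^sup>+x. ennreal (norm (decay_weight (x::'a))) \<partial>lborel)
     \<le> (\<integral>\<^sup>+x. (\<Prod>b\<in>Basis. ennreal (inverse (1 + ((x::'a) \<bullet> b)^2))) \<partial>lborel)"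
    by (intro nn_integral_mono)
  also have "\<dots> = (\<Prod>b\<in>(Basis::'a set). (\<integral>\<^sup>+x. ennreal (inverse (1 + x^2)) \<partial>lborel))"
    by (rule nn_integral_lborel_prod) auto
  also have "\<dots> < \<infinity>"
    using nn_integral_inverse_1_plus_square by (simp add: power_less_top_ennreal)
  finally show "(\<integral>\<^sup>+x. ennreal (norm (decay_weight (x::'a))) \<partial>lborel) < \<infinity>" .
qed auto

text \<open>The weight varies only by a bounded factor over unit distances, so the supremum of a derivative
  over a unit ball is still integrable in the centre of the ball.\<close>

lemma decay_weight_shift_le:
  fixes z w :: "'a::euclidean_space"
  assumes "norm (w - z) \<le> 1"
  shows "decay_weight w \<le> 3 ^ DIM('a) * decay_weight z"
proof -
  have "norm z \<le> norm w + 1" using assms norm_triangle_sub[of z w] by (simp add: norm_minus_commute)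
  then have "(norm z)^2 \<le> (norm w + 1)^2" by (intro power_mono) auto
  also have "\<dots> \<le> 2 * (norm w)^2 + 2" using sum_squares_bound[of "norm w" 1] by (simp add: power2_sum)
  finally have "1 + (norm z)^2 \<le> 3 + 2 * (norm w)^2" by simp
  also have "\<dots> \<le> 3 * (1 + (norm w)^2)" by (simp add: algebra_simps)
  finally have "1 + (norm z)^2 \<le> 3 * (1 + (norm w)^2)" .
  then have "(1 + (norm z)^2) ^ DIM('a) \<le> (3 * (1 + (norm w)^2)) ^ DIM('a)"
    by (intro power_mono) auto
  then have "(1 + (norm z)^2) ^ DIM('a) \<le> 3 ^ DIM('a) * (1 + (norm w)^2) ^ DIM('a)"
    by (simp only: power_mult_distrib)
  moreover have "0 < (1 + (norm z)^2) ^ DIM('a)" "0 < (1 + (norm w)^2) ^ DIM('a)"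
    by (auto intro!: zero_less_power add_pos_nonneg)
  ultimately show ?thesis
    unfolding decay_weight_def by (simp add: field_simps)
qed

section \<open>Schwartz functions\<close>

lemma iter_deriv_append: "iter_deriv (bs @ cs) f = iter_deriv bs (iter_deriv cs f)"
  by (induction bs) auto

lemma schwartz_differentiable: "schwartz f \<Longrightarrow> f differentiable (at x)"
  unfolding schwartz_def by (metis empty_subsetI iter_deriv.simps(1) list.set(1))

lemma schwartz_continuous: "schwartz f \<Longrightarrow> continuous_on UNIV f"
  by (simp add: schwartz_differentiable continuous_at_imp_continuous_on differentiable_imp_continuous_within)

lemma schwartz_measurable: "schwartz f \<Longrightarrow> f \<in> borel_measurable borel"
  by (intro borel_measurable_continuous_onI schwartz_continuous)

lemma schwartz_partial:
  fixes f :: "'a::euclidean_space \<Rightarrow> complex"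
  assumes "schwartz f" "b \<in> Basis"
  shows "schwartz (\<lambda>x. frechet_derivative f (at x) b)"
proof -
  have "(\<lambda>x. frechet_derivative f (at x) b) = iter_deriv [b] f" by simp
  then show ?thesis
    using assms unfolding schwartz_def
    by (simp add: iter_deriv_append[symmetric] del: iter_deriv.simps)
qed

lemma schwartz_weighted_bound:
  fixes f :: "'a::euclidean_space \<Rightarrow> complex"
  assumes "schwartz f"
  obtains C where "0 \<le> C" "\<And>x. norm x ^ k * norm (f x) \<le> C"
proof -
  have "bounded (range (\<lambda>x. norm x ^ k *\<^sub>R iter_deriv [] f x))"
    using assms unfolding schwartz_def by (metis empty_subsetI list.set(1))
  then obtain C where "\<And>x. norm (norm x ^ k *\<^sub>R f x) \<le> C"
    unfolding bounded_iff by auto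
  then have "norm x ^ k * norm (f x) \<le> \<bar>C\<bar>" for x
    by (smt (verit) norm_scaleR abs_of_nonneg zero_le_power norm_ge_zero)
  then show ?thesis using that[of "\<bar>C\<bar>"] by auto
qed

lemma schwartz_bounded:
  fixes f :: "'a::euclidean_space \<Rightarrow> complex"
  assumes "schwartz f"
  obtains C where "0 \<le> C" "\<And>x. norm (f x) \<le> C"
  using schwartz_weighted_bound[OF assms, of 0] by auto

text \<open>The extra factor \<open>1 + \<bar>x\<bar>\<close> makes the first moment of a Schwartz function
  integrable too.\<close>

lemma schwartz_decay:
  fixes f :: "'a::euclidean_space \<Rightarrow> complex"
  assumes f: "schwartz f"
  obtains C where "0 \<le> C" "\<And>x. (1 + norm x) * norm (f x) \<le> C * decay_weight x"
proof -
  define m where "m = 2 * DIM('a) + 1"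
  obtain C0 where C0: "0 \<le> C0" "\<And>x. norm (f x) \<le> C0" using schwartz_bounded[OF f] by auto
  obtain C1 where C1: "0 \<le> C1" "\<And>x. norm x ^ m * norm (f x) \<le> C1"
    using schwartz_weighted_bound[OF f, of m] by auto
  have "(1 + norm x) * norm (f x) \<le> (2 ^ m * (C0 + C1)) * decay_weight x" for x
  proof -
    let ?r = "norm x"
    have "(1 + ?r) ^ m \<le> 2 ^ m * (1 + ?r ^ m)"
    proof (cases "?r \<le> 1")
      case True
      then have "(1 + ?r) ^ m \<le> 2 ^ m" by (intro power_mono) auto
      also have "\<dots> \<le> 2 ^ m * (1 + ?r ^ m)" by simp
      finally show ?thesis .
    next
      case False
      then have "(1 + ?r) ^ m \<le> (2 * ?r) ^ m" by (intro power_mono) auto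
      also have "\<dots> \<le> 2 ^ m * (1 + ?r ^ m)" by (simp add: power_mult_distrib)
      finally show ?thesis .
    qed
    then have "(1 + ?r) ^ m * norm (f x) \<le> 2 ^ m * (1 + ?r ^ m) * norm (f x)"
      by (rule mult_right_mono) simp
    also have "\<dots> = 2 ^ m * (norm (f x) + ?r ^ m * norm (f x))" by (simp add: algebra_simps)
    also have "\<dots> \<le> 2 ^ m * (C0 + C1)" by (intro mult_left_mono add_mono C0 C1) auto
    finally have 1: "(1 + ?r) ^ m * norm (f x) \<le> 2 ^ m * (C0 + C1)" .
    have "(1 + ?r\<^sup>2) ^ DIM('a) \<le> ((1 + ?r)\<^sup>2) ^ DIM('a)"
      by (intro power_mono) (auto simp: power2_sum)
    also have "\<dots> = (1 + ?r) ^ (2 * DIM('a))" by (simp add: power_mult)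
    finally have "(1 + ?r) * (1 + ?r\<^sup>2) ^ DIM('a) \<le> (1 + ?r) ^ m"
      by (auto simp: m_def intro!: mult_left_mono)
    then have "(1 + ?r) * (1 + ?r\<^sup>2) ^ DIM('a) * norm (f x) \<le> 2 ^ m * (C0 + C1)"
      using 1 by (meson mult_right_mono norm_ge_zero order_trans)
    moreover have "0 < (1 + ?r\<^sup>2) ^ DIM('a)" by (auto intro!: zero_less_power add_pos_nonneg)
    ultimately show ?thesis by (simp add: decay_weight_def field_simps)
  qed
  moreover have "0 \<le> 2 ^ m * (C0 + C1)" using C0 C1 by simp
  ultimately show ?thesis using that by blast
qed

lemma schwartz_integrable_moment:
  fixes f :: "'a::euclidean_space \<Rightarrow> complex"
  assumes f: "schwartz f"
  shows "integrable lborel (\<lambda>x. (1 + norm x) * norm (f x))"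
proof -
  obtain C where C: "0 \<le> C" "\<And>x. (1 + norm x) * norm (f x) \<le> C * decay_weight x"
    using schwartz_decay[OF f] by auto
  have [measurable]: "f \<in> borel_measurable borel" by (rule schwartz_measurable[OF f])
  show ?thesis
  proof (rule Bochner_Integration.integrable_bound)
    show "integrable lborel (\<lambda>x::'a. C * decay_weight x)"
      by (intro integrable_mult_right integrable_decay_weight)
    show "AE x in lborel. norm ((1 + norm x) * norm (f x)) \<le> norm (C * decay_weight x)"
      using C order_trans[OF C(2) abs_ge_self] by (auto simp: abs_mult)
  qed measurable
qed

lemma schwartz_integrable:
  fixes f :: "'a::euclidean_space \<Rightarrow> complex"
  assumes f: "schwartz f"
  shows "integrable lborel f"
  by (rule Bochner_Integration.integrable_bound[OF schwartz_integrable_moment[OF f]])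
     (auto simp: schwartz_measurable[OF f] abs_mult algebra_simps)

lemma schwartz_derivative_decay:
  fixes f :: "'a::euclidean_space \<Rightarrow> complex"
  assumes f: "schwartz f"
  obtains C where "0 \<le> C"
    "\<And>x. onorm (frechet_derivative f (at x)) \<le> C * decay_weight x"
proof -
  have "\<exists>C. 0 \<le> C \<and> (\<forall>x. norm (frechet_derivative f (at x) b) \<le> C * decay_weight x)"
    if b: "b \<in> Basis" for b
  proof -
    obtain C where C: "0 \<le> C"
      "\<And>x. (1 + norm x) * norm (frechet_derivative f (at x) b) \<le> C * decay_weight x"
      using schwartz_decay[OF schwartz_partial[OF f b]] by auto
    have "norm (frechet_derivative f (at x) b) \<le> C * decay_weight x" for x
      using C(2)[of x] by (smt (verit) mult_le_cancel_right1 norm_ge_zero)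
    then show ?thesis using C by blast
  qed
  then obtain C where C: "\<And>b. b \<in> Basis \<Longrightarrow> 0 \<le> C b"
    "\<And>b x. b \<in> Basis \<Longrightarrow> norm (frechet_derivative f (at x) b) \<le> C b * decay_weight x"
    by metis
  have "onorm (frechet_derivative f (at x)) \<le> (\<Sum>b\<in>Basis. C b) * decay_weight x" for x
  proof (rule onorm_le)
    fix v :: 'a
    have lin: "linear (frechet_derivative f (at x))"
      by (rule linear_frechet_derivative[OF schwartz_differentiable[OF f]])
    have "frechet_derivative f (at x) v = frechet_derivative f (at x) (\<Sum>b\<in>Basis. (v \<bullet> b) *\<^sub>R b)"
      by (simp add: euclidean_representation)
    also have "\<dots> = (\<Sum>b\<in>Basis. (v \<bullet> b) *\<^sub>R frechet_derivative f (at x) b)"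
      by (simp add: linear_sum[OF lin] linear_scale[OF lin])
    finally have "norm (frechet_derivative f (at x) v)
          \<le> (\<Sum>b\<in>Basis. norm ((v \<bullet> b) *\<^sub>R frechet_derivative f (at x) b))"
      by (simp only: norm_sum)
    also have "\<dots> \<le> (\<Sum>b\<in>Basis. norm v * (C b * decay_weight x))"
      by (intro sum_mono) (auto intro!: mult_mono C Basis_le_norm)
    also have "\<dots> = (\<Sum>b\<in>Basis. C b) * decay_weight x * norm v"
      by (simp add: sum_distrib_left sum_distrib_right mult_ac)
    finally show "norm (frechet_derivative f (at x) v) \<le> (\<Sum>b\<in>Basis. C b) * decay_weight x * norm v" .
  qed
  moreover have "0 \<le> (\<Sum>b\<in>Basis. C b)" using C by (intro sum_nonneg) auto
  ultimately show ?thesis using that by blast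
qed

lemma schwartz_has_derivative:
  "schwartz f \<Longrightarrow> (f has_derivative frechet_derivative f (at x)) (at x within S)"
  using schwartz_differentiable frechet_derivative_works has_derivative_at_withinI by blast

lemma schwartz_lipschitz:
  fixes f :: "'a::euclidean_space \<Rightarrow> complex"
  assumes f: "schwartz f"
  obtains C where "0 \<le> C" "\<And>x y. norm (f x - f y) \<le> C * norm (x - y)"
proof -
  obtain C where C: "0 \<le> C" "\<And>x. onorm (frechet_derivative f (at x)) \<le> C * decay_weight x"
    using schwartz_derivative_decay[OF f] by auto
  have "decay_weight x \<le> 1" for x :: 'a
    unfolding decay_weight_def by (intro inverse_le_1_iff[THEN iffD2] disjI2 one_le_power) simp
  then have "C * decay_weight x \<le> C" for x :: 'a using C(1) by (simp add: mult_left_le)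
  then have "onorm (frechet_derivative f (at x)) \<le> C" for x
    using C(2) order_trans by blast
  then have "norm (f x - f y) \<le> C * norm (x - y)" for x y
    by (intro differentiable_bound[of UNIV f "\<lambda>x. frechet_derivative f (at x)"])
       (auto intro: schwartz_has_derivative[OF f])
  then show ?thesis using C(1) that by blast
qed

text \<open>For short translations, the mean value theorem bounds the increment by
  \<open>\<bar>h\<bar>\<close> times the integrable weight. For long ones, the triangle
  inequality suffices because \<open>\<bar>h\<bar> > 1\<close>.\<close>

lemma schwartz_translation_L1:
  fixes f :: "'a::euclidean_space \<Rightarrow> complex"
  assumes f: "schwartz f"
  obtains C where "0 \<le> C"
    "\<And>h. (\<integral>\<^sup>+x. ennreal (norm (f (x + h) - f x)) \<partial>lborel) \<le> ennreal (C * norm h)"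
proof -
  note [measurable] = schwartz_measurable[OF f]
  obtain C where C: "0 \<le> C" "\<And>x. onorm (frechet_derivative f (at x)) \<le> C * decay_weight x"
    using schwartz_derivative_decay[OF f] by auto
  define I where "I = (LINT x|lborel. decay_weight (x::'a))"
  define J where "J = (LINT x|lborel. norm (f x))"
  have I: "(\<integral>\<^sup>+x. ennreal (decay_weight (x::'a)) \<partial>lborel) = ennreal I"
    unfolding I_def
    by (rule nn_integral_eq_integral) (auto simp: integrable_decay_weight less_imp_le decay_weight_pos)
  have J: "(\<integral>\<^sup>+x. ennreal (norm (f x)) \<partial>lborel) = ennreal J"
    unfolding J_def by (rule nn_integral_eq_integral) (auto intro: schwartz_integrable[OF f])
  have I0: "0 \<le> I" and J0: "0 \<le> J"
    unfolding I_def J_def by (auto intro!: integral_nonneg_AE simp: decay_weight_pos less_imp_le)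
  let ?C = "3 ^ DIM('a) * C * I + 2 * J"
  have C0: "0 \<le> ?C" using C(1) I0 J0 by simp
  have "(\<integral>\<^sup>+x. ennreal (norm (f (x + h) - f x)) \<partial>lborel) \<le> ennreal (?C * norm h)" for h
  proof (cases "norm h \<le> 1")
    case True
    have local: "norm (f (x + h) - f x) \<le> (C * 3 ^ DIM('a) * norm h) * decay_weight x" for x
    proof -
      have "norm (f (x + h) - f x) \<le> (C * (3 ^ DIM('a) * decay_weight x)) * norm (x + h - x)"
      proof (rule differentiable_bound[of "cball x 1"])
        show "(f has_derivative frechet_derivative f (at y)) (at y within cball x 1)" for y
          by (rule schwartz_has_derivative[OF f])
        show "onorm (frechet_derivative f (at y)) \<le> C * (3 ^ DIM('a) * decay_weight x)"
          if "y \<in> cball x 1" for y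
          using C(2)[of y] mult_left_mono[OF decay_weight_shift_le[of y x] C(1)] that
          by (force simp: dist_norm norm_minus_commute)
      qed (use True in \<open>auto simp: dist_norm\<close>)
      then show ?thesis by (simp add: mult_ac)
    qed
    have "(\<integral>\<^sup>+x. ennreal (norm (f (x + h) - f x)) \<partial>lborel)
        \<le> (\<integral>\<^sup>+x. ennreal (C * 3 ^ DIM('a) * norm h) * ennreal (decay_weight (x::'a)) \<partial>lborel)"
      by (intro nn_integral_mono)
         (use local C(1) in \<open>auto simp: ennreal_mult'[symmetric] intro!: ennreal_leI\<close>)
    also have "\<dots> = ennreal (C * 3 ^ DIM('a) * norm h * I)"
      using C(1) I0 by (subst nn_integral_cmult) (auto simp: I ennreal_mult'[symmetric])
    also have "\<dots> \<le> ennreal (?C * norm h)"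
      using J0 by (intro ennreal_leI) (simp add: algebra_simps)
    finally show ?thesis .
  next
    case False
    have "(\<integral>\<^sup>+x. ennreal (norm (f (x + h) - f x)) \<partial>lborel)
        \<le> (\<integral>\<^sup>+x. ennreal (norm (f (x + h))) + ennreal (norm (f x)) \<partial>lborel)"
      by (intro nn_integral_mono)
         (simp add: ennreal_plus[symmetric] norm_triangle_ineq4 ennreal_leI del: ennreal_plus)
    also have "\<dots> = ennreal (2 * J)"
      using nn_integral_lborel_shift[of "\<lambda>x. ennreal (norm (f x))" "- h"] J0
      by (subst nn_integral_add) (auto simp: J ennreal_plus[symmetric] simp del: ennreal_plus)
    also have "\<dots> \<le> ennreal (?C * norm h)"
    proof (rule ennreal_leI)
      have "2 * J \<le> ?C" using C(1) I0 by simp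
      also have "\<dots> \<le> ?C * norm h" using mult_left_mono[OF _ C0, of 1 "norm h"] False by simp
      finally show "2 * J \<le> ?C * norm h" .
    qed
    finally show ?thesis .
  qed
  with C0 show ?thesis using that by blast
qed

section \<open>Gaussian cutoffs\<close>

definition gaussian :: "'a::euclidean_space \<Rightarrow> real \<Rightarrow> 'a \<Rightarrow> real" where
  "gaussian c l x = exp (- (norm (x - c) / l)\<^sup>2)"

lemma gaussian_pos: "0 < gaussian c l x" and gaussian_le_1: "gaussian c l x \<le> 1"
  by (auto simp: gaussian_def)

lemma continuous_gaussian: "continuous_on UNIV (gaussian c l)"
  unfolding gaussian_def[abs_def] divide_inverse by (intro continuous_intros)

lemma borel_measurable_gaussian [measurable]: "gaussian c l \<in> borel_measurable borel"
  by (intro borel_measurable_continuous_onI continuous_gaussian)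

lemma gaussian_has_derivative:
  "(gaussian c l has_derivative (\<lambda>h. - 2 / l\<^sup>2 * ((x - c) \<bullet> h) * gaussian c l x)) (at x)"
proof -
  have "gaussian c l = (\<lambda>x. exp (- ((x - c) \<bullet> (x - c)) / l\<^sup>2))"
    by (auto simp: gaussian_def power_divide power2_norm_eq_inner)
  moreover have "((\<lambda>x. exp (- ((x - c) \<bullet> (x - c)) / l\<^sup>2)) has_derivative
      (\<lambda>h. - 2 / l\<^sup>2 * ((x - c) \<bullet> h) * exp (- ((x - c) \<bullet> (x - c)) / l\<^sup>2))) (at x)"
    by (auto intro!: derivative_eq_intros simp: fun_eq_iff inner_commute algebra_simps divide_inverse)
  ultimately show ?thesis by simp
qed

text \<open>The iterated derivatives of \<open>f\<close> times a Gaussian all lie in the span of the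
  products of a derivative of \<open>f\<close>, a monomial in \<open>x - c\<close> and the
  Gaussian. This span is closed under partial derivatives and consists of rapidly decreasing
  functions, so induction on the list of derivatives shows that the product is Schwartz.\<close>

inductive gaussian_multiple ::
  "('a::euclidean_space \<Rightarrow> complex) \<Rightarrow> 'a \<Rightarrow> real \<Rightarrow> ('a \<Rightarrow> complex) \<Rightarrow> bool"
  for f :: "'a \<Rightarrow> complex" and c :: 'a and l :: real
where
  base: "set bs \<subseteq> Basis \<Longrightarrow>
           gaussian_multiple f c l (\<lambda>x. iter_deriv bs f x * complex_of_real (gaussian c l x))"
| coord: "gaussian_multiple f c l h \<Longrightarrow> b \<in> Basis \<Longrightarrow>
           gaussian_multiple f c l (\<lambda>x. complex_of_real ((x - c) \<bullet> b) * h x)"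
| scale: "gaussian_multiple f c l h \<Longrightarrow> gaussian_multiple f c l (\<lambda>x. complex_of_real a * h x)"
| plus: "gaussian_multiple f c l h \<Longrightarrow> gaussian_multiple f c l h' \<Longrightarrow>
           gaussian_multiple f c l (\<lambda>x. h x + h' x)"

lemma gaussian_multiple_derivative:
  fixes f :: "'a::euclidean_space \<Rightarrow> complex"
  assumes f: "schwartz f" and h: "gaussian_multiple f c l h"
  shows "(\<forall>x. h differentiable (at x)) \<and>
    (\<forall>b\<in>Basis. gaussian_multiple f c l (\<lambda>x. frechet_derivative h (at x) b))"
  using h
proof induction
  case (base bs)
  let ?h = "\<lambda>x. iter_deriv bs f x * complex_of_real (gaussian c l x)"
  have D: "(?h has_derivative (\<lambda>v. iter_deriv bs f x * complex_of_real (- 2 / l\<^sup>2 * ((x - c) \<bullet> v) * gaussian c l x)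
      + frechet_derivative (iter_deriv bs f) (at x) v * complex_of_real (gaussian c l x))) (at x)" for x
  proof -
    have "(iter_deriv bs f has_derivative frechet_derivative (iter_deriv bs f) (at x)) (at x)"
      using f base frechet_derivative_works unfolding schwartz_def by blast
    then show ?thesis
      by (rule has_derivative_mult[OF _ has_derivative_of_real[OF gaussian_has_derivative]])
  qed
  have "gaussian_multiple f c l (\<lambda>x. frechet_derivative ?h (at x) b)" if b: "b \<in> Basis" for b
  proof -
    have "(\<lambda>x. frechet_derivative ?h (at x) b)
        = (\<lambda>x. complex_of_real (- 2 / l\<^sup>2) * (complex_of_real ((x - c) \<bullet> b) * ?h x)
             + iter_deriv (b # bs) f x * complex_of_real (gaussian c l x))"
      by (rule ext, subst frechet_derivative_at[OF D, symmetric]) (simp add: mult_ac)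
    then show ?thesis
      using base b
      by (auto intro!: gaussian_multiple.intros simp del: iter_deriv.simps of_real_divide of_real_minus)
  qed
  then show ?case using D by (auto simp: differentiable_def)
next
  case (coord h b)
  let ?h = "\<lambda>x. complex_of_real ((x - c) \<bullet> b) * h x"
  have D: "(?h has_derivative (\<lambda>v. complex_of_real ((x - c) \<bullet> b) * frechet_derivative h (at x) v
      + complex_of_real (v \<bullet> b) * h x)) (at x)" for x
  proof -
    have "(h has_derivative frechet_derivative h (at x)) (at x)"
      using coord frechet_derivative_works by blast
    moreover have "((\<lambda>x. complex_of_real ((x - c) \<bullet> b)) has_derivative (\<lambda>v. complex_of_real (v \<bullet> b))) (at x)"
      by (rule has_derivative_of_real) (auto intro!: derivative_eq_intros)
    ultimately show ?thesis by (rule has_derivative_mult[rotated])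
  qed
  have "gaussian_multiple f c l (\<lambda>x. frechet_derivative ?h (at x) b')" if b': "b' \<in> Basis" for b'
  proof -
    have "(\<lambda>x. frechet_derivative ?h (at x) b')
        = (\<lambda>x. complex_of_real ((x - c) \<bullet> b) * frechet_derivative h (at x) b' + complex_of_real (b' \<bullet> b) * h x)"
      by (rule ext, subst frechet_derivative_at[OF D, symmetric]) simp
    then show ?thesis
      using coord b' by (auto intro!: gaussian_multiple.intros)
  qed
  then show ?case using D by (auto simp: differentiable_def)
next
  case (scale h a)
  have D: "((\<lambda>x. complex_of_real a * h x) has_derivative
      (\<lambda>v. complex_of_real a * frechet_derivative h (at x) v)) (at x)" for x
    using scale frechet_derivative_works by (intro has_derivative_mult_right) blast
  have "(\<lambda>x. frechet_derivative (\<lambda>x. complex_of_real a * h x) (at x) b)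
      = (\<lambda>x. complex_of_real a * frechet_derivative h (at x) b)" for b
    by (rule ext, subst frechet_derivative_at[OF D, symmetric]) simp
  then show ?case
    using D scale by (auto simp: differentiable_def intro!: gaussian_multiple.intros)
next
  case (plus h h')
  have D: "((\<lambda>x. h x + h' x) has_derivative
      (\<lambda>v. frechet_derivative h (at x) v + frechet_derivative h' (at x) v)) (at x)" for x
    using plus frechet_derivative_works by (intro has_derivative_add) blast+
  have "(\<lambda>x. frechet_derivative (\<lambda>x. h x + h' x) (at x) b)
      = (\<lambda>x. frechet_derivative h (at x) b + frechet_derivative h' (at x) b)" for b
    by (rule ext, subst frechet_derivative_at[OF D, symmetric]) simp
  then show ?case
    using D plus by (auto simp: differentiable_def intro!: gaussian_multiple.intros)
qed

lemma gaussian_multiple_bounded: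
  fixes f :: "'a::euclidean_space \<Rightarrow> complex"
  assumes f: "schwartz f" and h: "gaussian_multiple f c l h"
  shows "\<exists>C. \<forall>x. norm x ^ k * norm (h x) \<le> C"
  using h
proof (induction arbitrary: k)
  case (base bs)
  have "bounded (range (\<lambda>x. norm x ^ k *\<^sub>R iter_deriv bs f x))"
    using f base unfolding schwartz_def by blast
  then obtain C where C: "\<And>x. norm (norm x ^ k *\<^sub>R iter_deriv bs f x) \<le> C"
    unfolding bounded_iff by auto
  have "norm x ^ k * norm (iter_deriv bs f x * complex_of_real (gaussian c l x)) \<le> C" for x
  proof -
    have "norm x ^ k * norm (iter_deriv bs f x * complex_of_real (gaussian c l x))
        = norm (norm x ^ k *\<^sub>R iter_deriv bs f x) * gaussian c l x"
      using gaussian_pos[of c l x] by (simp add: norm_mult)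
    also have "\<dots> \<le> norm (norm x ^ k *\<^sub>R iter_deriv bs f x)"
      using gaussian_le_1[of c l x] gaussian_pos[of c l x] by (intro mult_left_le) auto
    finally show ?thesis using C[of x] by linarith
  qed
  then show ?case by blast
next
  case (coord h b)
  obtain C C' where C: "\<And>x. norm x ^ Suc k * norm (h x) \<le> C" and C': "\<And>x. norm x ^ k * norm (h x) \<le> C'"
    using coord.IH[of "Suc k"] coord.IH[of k] by auto
  have "norm x ^ k * norm (complex_of_real ((x - c) \<bullet> b) * h x) \<le> C + norm c * C'" for x
  proof -
    have "\<bar>(x - c) \<bullet> b\<bar> \<le> norm x + norm c"
      using Basis_le_norm[OF coord.hyps(2), of "x - c"] norm_triangle_ineq4[of x c] by linarith
    then have "norm x ^ k * (\<bar>(x - c) \<bullet> b\<bar> * norm (h x)) \<le> norm x ^ k * ((norm x + norm c) * norm (h x))"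
      by (intro mult_left_mono mult_right_mono) auto
    also have "\<dots> = norm x ^ Suc k * norm (h x) + norm c * (norm x ^ k * norm (h x))"
      by (simp add: algebra_simps)
    also have "\<dots> \<le> C + norm c * C'" by (intro add_mono mult_left_mono C C') auto
    finally show ?thesis by (simp add: norm_mult)
  qed
  then show ?case by blast
next
  case (scale h a)
  obtain C where C: "\<And>x. norm x ^ k * norm (h x) \<le> C" using scale.IH by blast
  have "norm x ^ k * norm (complex_of_real a * h x) \<le> \<bar>a\<bar> * C" for x
    using mult_left_mono[OF C[of x], of "\<bar>a\<bar>"] by (simp add: norm_mult mult_ac)
  then show ?case by blast
next
  case (plus h h')
  obtain C C' where C: "\<And>x. norm x ^ k * norm (h x) \<le> C" and C': "\<And>x. norm x ^ k * norm (h' x) \<le> C'"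
    using plus.IH by metis
  have "norm x ^ k * norm (h x + h' x) \<le> C + C'" for x
    using mult_left_mono[OF norm_triangle_ineq[of "h x" "h' x"], of "norm x ^ k"] C[of x] C'[of x]
    by (simp add: distrib_left)
  then show ?case by blast
qed

lemma schwartz_mult_gaussian:
  fixes f :: "'a::euclidean_space \<Rightarrow> complex"
  assumes f: "schwartz f"
  shows "schwartz (\<lambda>x. f x * complex_of_real (gaussian c l x))"
proof -
  let ?g = "\<lambda>x. f x * complex_of_real (gaussian c l x)"
  have GM: "gaussian_multiple f c l (iter_deriv bs ?g)" if "set bs \<subseteq> Basis" for bs
    using that
  proof (induction bs)
    case Nil
    show ?case using gaussian_multiple.base[of "[]" f c l] by simp
  next
    case (Cons b bs)
    then show ?case using gaussian_multiple_derivative[OF f] by simp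
  qed
  show ?thesis
    unfolding schwartz_def
  proof (intro allI impI conjI)
    fix bs :: "'a list" and k :: nat and x
    assume bs: "set bs \<subseteq> Basis"
    show "iter_deriv bs ?g differentiable (at x)"
      using gaussian_multiple_derivative[OF f GM[OF bs]] by blast
    show "bounded (range (\<lambda>x. norm x ^ k *\<^sub>R iter_deriv bs ?g x))"
      using gaussian_multiple_bounded[OF f GM[OF bs], of k] by (auto simp: bounded_iff)
  qed
qed

lemma exp_minus_square_lipschitz:
  fixes s t :: real
  shows "\<bar>exp (- s\<^sup>2) - exp (- t\<^sup>2)\<bar> \<le> \<bar>s - t\<bar>"
proof -
  have "norm (exp (- s\<^sup>2) - exp (- t\<^sup>2)) \<le> 1 * norm (s - t)"
  proof (rule field_differentiable_bound[of UNIV _ "\<lambda>u. - 2 * u * exp (- u\<^sup>2)"])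
    show "((\<lambda>u. exp (- u\<^sup>2)) has_field_derivative - 2 * u * exp (- u\<^sup>2)) (at u within UNIV)" for u :: real
      by (auto intro!: derivative_eq_intros)
    show "norm (- 2 * u * exp (- u\<^sup>2)) \<le> 1" for u :: real
    proof -
      have "2 * \<bar>u\<bar> \<le> 1 + u\<^sup>2" using sum_squares_bound[of 1 "\<bar>u\<bar>"] by simp
      also have "\<dots> \<le> exp (u\<^sup>2)" by (rule exp_ge_add_one_self)
      finally show ?thesis by (simp add: abs_mult exp_minus field_simps)
    qed
  qed auto
  then show ?thesis by simp
qed

text \<open>The constant is \<open>1 / l\<close> because \<open>t \<mapsto> exp (- t\<^sup>2)\<close> has
  derivative at most \<open>1\<close> in absolute value, by \<open>2 \<bar>t\<bar> \<le> 1 +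
  t\<^sup>2 \<le> exp (t\<^sup>2)\<close>.\<close>

lemma gaussian_lipschitz:
  assumes "0 < l"
  shows "\<bar>gaussian c l x - gaussian c l y\<bar> \<le> norm (x - y) / l"
proof -
  have "\<bar>gaussian c l x - gaussian c l y\<bar> \<le> \<bar>norm (x - c) / l - norm (y - c) / l\<bar>"
    unfolding gaussian_def by (rule exp_minus_square_lipschitz)
  also have "\<dots> = \<bar>norm (x - c) - norm (y - c)\<bar> / l"
    using assms by (simp add: diff_divide_distrib[symmetric])
  also have "\<dots> \<le> norm (x - y) / l"
    using norm_triangle_ineq3[of "x - c" "y - c"] assms by (intro divide_right_mono) auto
  finally show ?thesis .
qed

text \<open>Take the \<open>d\<close>-th power of \<open>1 + t \<le> d (1 + t / d) \<le> d exp (t /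
  d)\<close> with \<open>t = \<bar>x\<bar>\<^sup>2\<close>.\<close>

lemma gaussian_le_decay_weight:
  "gaussian 0 1 x \<le> real DIM('a) ^ DIM('a) * decay_weight (x :: 'a::euclidean_space)"
proof -
  let ?d = "real DIM('a)" and ?t = "(norm x)\<^sup>2"
  have d: "1 \<le> ?d" by (simp add: Suc_leI)
  have "1 + ?t \<le> ?d * (1 + ?t / ?d)" using d by (simp add: distrib_left)
  also have "\<dots> \<le> ?d * exp (?t / ?d)" by (intro mult_left_mono exp_ge_add_one_self) auto
  finally have "(1 + ?t) ^ DIM('a) \<le> (?d * exp (?t / ?d)) ^ DIM('a)" by (intro power_mono) auto
  also have "\<dots> = ?d ^ DIM('a) * exp ?t"
    by (simp add: power_mult_distrib exp_of_nat_mult[symmetric])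
  finally have 1: "(1 + ?t) ^ DIM('a) \<le> ?d ^ DIM('a) * exp ?t" .
  have "0 < (1 + ?t) ^ DIM('a)" by (auto intro!: zero_less_power add_pos_nonneg)
  with 1 show ?thesis
    by (simp add: gaussian_def decay_weight_def exp_minus field_simps)
qed

section \<open>Integration over the sphere\<close>

text \<open>On a finite measure space, \<open>L\<^sup>q\<close> embeds into \<open>L\<^sup>1\<close>. With
  \<open>N > 0\<close> the norm, integrate \<open>\<bar>f\<bar> \<le> N (1 + (\<bar>f\<bar> /
  N)^q)\<close>; the resulting constant is independent of \<open>q\<close>.\<close>

lemma nn_integral_le_Lp_norm:
  fixes f :: "'a \<Rightarrow> complex"
  assumes q: "1 \<le> q" and [measurable]: "f \<in> borel_measurable M"
  shows "(\<integral>\<^sup>+x. ennreal (norm (f x)) \<partial>M) \<le> (1 + emeasure M (space M)) * Lp_norm M q f"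
proof (cases "q = \<infinity>")
  case True
  have "(\<integral>\<^sup>+x. ennreal (norm (f x)) \<partial>M) \<le> (\<integral>\<^sup>+x. esssup M (\<lambda>x. ennreal (norm (f x))) \<partial>M)"
    by (rule nn_integral_mono_AE) (rule esssup_AE)
  also have "\<dots> = emeasure M (space M) * Lp_norm M q f"
    using True by (simp add: Lp_norm_def mult.commute)
  also have "\<dots> \<le> (1 + emeasure M (space M)) * Lp_norm M q f"
    by (intro mult_right_mono) auto
  finally show ?thesis .
next
  case False
  define p where "p = enn2real q"
  have p: "1 \<le> p"
    using q False unfolding p_def by (metis enn2real_1 enn2real_mono infinity_ennreal_def top.not_eq_extremum)
  define I where "I = (\<integral>\<^sup>+x. ennreal (norm (f x) powr p) \<partial>M)"
  show ?thesis
  proof (cases "I = \<infinity>")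
    case True
    then have "Lp_norm M q f = \<infinity>" using False by (simp add: Lp_norm_def I_def p_def)
    then show ?thesis by (simp add: ennreal_mult_top)
  next
    case fin: False
    define N where "N = enn2real I powr (1 / p)"
    have norm_eq: "Lp_norm M q f = ennreal N"
      using False fin by (simp add: Lp_norm_def I_def p_def N_def)
    have N0: "0 \<le> N" by (simp add: N_def)
    have I_eq: "I = ennreal (N powr p)"
      using fin p by (simp add: N_def powr_powr less_top[symmetric])
    show ?thesis
    proof (cases "N = 0")
      case True
      then have "I = 0" using p by (simp add: I_eq)
      then have "AE x in M. f x = 0"
        unfolding I_def by (subst (asm) nn_integral_0_iff_AE) (use p in auto)
      then have "(\<integral>\<^sup>+x. ennreal (norm (f x)) \<partial>M) = 0"
        by (subst nn_integral_0_iff_AE) auto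
      then show ?thesis by simp
    next
      case False
      then have N: "0 < N" using N0 by simp
      have le: "norm (f x) \<le> N + N powr (1 - p) * norm (f x) powr p" for x
      proof -
        have "t \<le> 1 + t powr p" if "0 \<le> t" for t :: real
          using powr_mono[OF p, of t] that by (cases "t \<le> 1") (auto simp: add_increasing2)
        from this[of "norm (f x) / N"] N
        have "norm (f x) \<le> N * (1 + (norm (f x) / N) powr p)" by (simp add: field_simps)
        also have "\<dots> = N + N powr (1 - p) * norm (f x) powr p"
          using N by (simp add: powr_divide powr_diff field_simps)
        finally show ?thesis .
      qed
      have "(\<integral>\<^sup>+x. ennreal (norm (f x)) \<partial>M)
          \<le> (\<integral>\<^sup>+x. ennreal N + ennreal (N powr (1 - p)) * ennreal (norm (f x) powr p) \<partial>M)"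
        by (intro nn_integral_mono)
           (use le N in \<open>auto simp: ennreal_mult'[symmetric] ennreal_plus[symmetric] intro!: ennreal_leI simp del: ennreal_plus\<close>)
      also have "\<dots> = ennreal N * emeasure M (space M) + ennreal (N powr (1 - p)) * I"
        by (subst nn_integral_add) (auto simp: nn_integral_cmult I_def)
      also have "ennreal (N powr (1 - p)) * I = ennreal N"
        using N by (simp add: I_eq ennreal_mult'[symmetric] powr_add[symmetric])
      finally show ?thesis
        by (simp add: norm_eq distrib_left mult.commute add.commute)
    qed
  qed
qed

lemma sets_sphere_measure:
  "sets (sphere_measure :: 'a::euclidean_space measure) = sets (restrict_space borel (sphere 0 1))"
  by (simp add: sphere_measure_def)

lemma measurable_sgn_sphere:
  "sgn \<in> restrict_space lborel (cball 0 1 - {0}) \<rightarrow>\<^sub>M restrict_space borel (sphere (0::'a::euclidean_space) 1)"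
  by (rule measurable_restrict_space2)
     (auto simp: norm_sgn space_restrict_space sgn_div_norm[abs_def] intro!: measurable_restrict_space1)

text \<open>The surface measure is a cone measure, so an integral over the sphere is a solid integral over
  the unit ball of the integrand extended homogeneously of degree zero. This is the form in
  which the kernel meets it.\<close>

lemma nn_integral_sphere_measure:
  fixes g :: "'a::euclidean_space \<Rightarrow> ennreal"
  assumes g: "g \<in> borel_measurable sphere_measure"
  shows "(\<integral>\<^sup>+\<theta>. g \<theta> \<partial>sphere_measure)
           = of_nat DIM('a) * (\<integral>\<^sup>+x. g (sgn x) * indicator (cball 0 1 - {0}) x \<partial>lborel)"
proof -
  have g': "g \<in> borel_measurable (restrict_space borel (sphere 0 1))"
    using g sets_sphere_measure measurable_cong_sets by blast
  have "(\<integral>\<^sup>+\<theta>. g \<theta> \<partial>sphere_measure)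
      = of_nat DIM('a) * (\<integral>\<^sup>+\<theta>. g \<theta> \<partial>distr (restrict_space lborel (cball 0 1 - {0})) (restrict_space borel (sphere 0 1)) sgn)"
    unfolding sphere_measure_def by (rule nn_integral_scale_measure) (simp add: g')
  also have "\<dots> = of_nat DIM('a) * (\<integral>\<^sup>+x. g (sgn x) \<partial>restrict_space lborel (cball 0 1 - {0}))"
    by (subst nn_integral_distr[OF measurable_sgn_sphere]) (auto simp: g')
  finally show ?thesis by (simp add: nn_integral_restrict_space)
qed

lemma emeasure_sphere_measure_finite:
  "emeasure (sphere_measure :: 'a::euclidean_space measure) (space sphere_measure) < \<infinity>"
proof -
  have "emeasure sphere_measure (space (sphere_measure :: 'a measure)) 
       = (\<integral>\<^sup>+\<theta>. 1 \<partial>(sphere_measure :: 'a measure))" by simp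
  also have "\<dots> = of_nat DIM('a) * emeasure lborel (cball 0 1 - {0::'a})"
    by (subst nn_integral_sphere_measure) auto
  also have "\<dots> \<le> of_nat DIM('a) * emeasure lborel (cball 0 1 :: 'a set)"
    by (intro mult_left_mono emeasure_mono) auto
  also have "\<dots> < \<infinity>"
    using emeasure_lborel_cball_finite[of "0::'a" 1]
    by (simp add: ennreal_mult_less_top of_nat_less_top)
  finally show ?thesis .
qed

lemma borel_measurable_sphere_comp_sgn:
  fixes \<Omega> :: "'a::euclidean_space \<Rightarrow> complex"
  assumes "\<Omega> \<in> borel_measurable sphere_measure"
  shows "(\<lambda>y. if y = 0 then 0 else \<Omega> (sgn y)) \<in> borel_measurable borel"
proof -
  have "\<Omega> \<in> borel_measurable (restrict_space borel (sphere 0 1))"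
    using assms sets_sphere_measure measurable_cong_sets by blast
  then have [measurable]: "(\<lambda>\<theta>. indicator (sphere 0 1) \<theta> *\<^sub>R \<Omega> \<theta>) \<in> borel_measurable borel"
    by (subst (asm) borel_measurable_restrict_space_iff) auto
  have [measurable]: "(sgn :: 'a \<Rightarrow> 'a) \<in> borel_measurable borel"
    unfolding sgn_div_norm[abs_def] by measurable
  have "(\<lambda>y. if y = 0 then 0 else \<Omega> (sgn y))
      = (\<lambda>y. if y = 0 then 0 else indicator (sphere 0 1) (sgn y) *\<^sub>R \<Omega> (sgn y))"
    by (auto simp: fun_eq_iff norm_sgn)
  also have "\<dots> \<in> borel_measurable borel"
    by (intro measurable_If measurable_compose[of sgn borel borel "\<lambda>\<theta>. indicator (sphere 0 1) \<theta> *\<^sub>R \<Omega> \<theta>"]) auto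
  finally show ?thesis .
qed

section \<open>Size and smoothness of the kernel pieces\<close>

lemma rough_kernel_eq_sgn:
  "rough_kernel \<Omega> y = (if y = 0 then 0 else \<Omega> (sgn y)) / complex_of_real (norm y) ^ DIM('a)"
  for y :: "'a::euclidean_space"
  by (simp add: rough_kernel_def sgn_div_norm)

lemma borel_measurable_fourier [measurable]:
  assumes [measurable]: "f \<in> borel_measurable borel"
  shows "fourier f \<in> borel_measurable borel"
  unfolding fourier_def[abs_def] by measurable

lemma norm_fourier_le: "norm (fourier f \<xi>) \<le> (LINT x|lborel. norm (f x))"
proof -
  have "norm (fourier f \<xi>) 
     \<le> (LINT x|lborel. norm (f x * exp (- 2 * pi * \<i> * complex_of_real (x \<bullet> \<xi>))))"
    unfolding fourier_def by (rule integral_norm_bound)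
  also have "\<dots> = (LINT x|lborel. norm (f x))"
    by (intro Bochner_Integration.integral_cong) (auto simp: norm_mult norm_exp_eq_Re)
  finally show ?thesis .
qed

lemma fourier_0: "fourier f 0 = (LINT x|lborel. f x)"
  by (simp add: fourier_def)

lemma borel_measurable_kernel_annulus:
  fixes \<Phi> \<Omega> :: "'a::euclidean_space \<Rightarrow> complex"
  assumes [measurable]: "\<Phi> \<in> borel_measurable borel" and \<Omega>: "\<Omega> \<in> borel_measurable sphere_measure"
  shows "kernel_annulus \<Phi> \<Omega> \<gamma> \<in> borel_measurable borel"
proof -
  note [measurable] = borel_measurable_sphere_comp_sgn[OF \<Omega>]
  show ?thesis
    unfolding kernel_annulus_def[abs_def] rough_kernel_eq_sgn[abs_def] by measurable
qed

lemma kernel_annulus_support: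
  assumes supp: "\<And>\<xi>. fourier \<Phi> \<xi> \<noteq> 0 \<Longrightarrow> 1/2 \<le> norm \<xi> \<and> norm \<xi> \<le> 2"
    and "kernel_annulus \<Phi> \<Omega> \<gamma> y \<noteq> 0"
  shows "1/2 \<le> 2 powi \<gamma> * norm y \<and> 2 powi \<gamma> * norm y \<le> 2"
  using supp[of "(2 powi \<gamma>) *\<^sub>R y"] assms(2) by (auto simp: kernel_annulus_def)

text \<open>On the annulus \<open>1/2 \<le> 2^\<gamma> \<bar>y\<bar> \<le> 2\<close> the factor
  \<open>\<bar>y\<bar>^-d\<close> is at most \<open>(2 2^\<gamma>)^d\<close>. What remains is
  the integral of a function of degree zero over the ball of radius \<open>2 /
  2^\<gamma>\<close>, and rescaling to the unit ball produces \<open>(2 / 2^\<gamma>)^d\<close>: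
  the powers of \<open>2^\<gamma>\<close> cancel.\<close>

lemma nn_integral_kernel_annulus_le:
  fixes \<Phi> \<Omega> :: "'a::euclidean_space \<Rightarrow> complex"
  assumes [measurable]: "\<Phi> \<in> borel_measurable borel" and \<Omega>: "\<Omega> \<in> borel_measurable sphere_measure"
    and supp: "\<And>\<xi>. fourier \<Phi> \<xi> \<noteq> 0 \<Longrightarrow> 1/2 \<le> norm \<xi> \<and> norm \<xi> \<le> 2"
  shows "(\<integral>\<^sup>+y. ennreal (norm (kernel_annulus \<Phi> \<Omega> \<gamma> y)) \<partial>lborel)
    \<le> ennreal (4 ^ DIM('a) * (LINT x|lborel. norm (\<Phi> x))) * (\<integral>\<^sup>+\<theta>. ennreal (norm (\<Omega> \<theta>)) \<partial>sphere_measure)"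
proof -
  note [measurable] = borel_measurable_sphere_comp_sgn[OF \<Omega>]
  define c :: real where "c = 2 powi \<gamma>"
  have c: "0 < c" by (simp add: c_def)
  define J where "J = (LINT x|lborel. norm (\<Phi> x))"
  have J: "0 \<le> J" unfolding J_def by simp
  define w where "w = (\<lambda>y::'a. if y = 0 then 0 else \<Omega> (sgn y))"
  have [measurable]: "w \<in> borel_measurable borel"
    unfolding w_def by measurable
  let ?S = "\<integral>\<^sup>+x. ennreal (norm (w x)) * indicator (cball 0 1) x \<partial>lborel"
  have S: "(\<integral>\<^sup>+\<theta>. ennreal (norm (\<Omega> \<theta>)) \<partial>sphere_measure) = of_nat DIM('a) * ?S"
  proof -
    have "(\<integral>\<^sup>+x. ennreal (norm (\<Omega> (sgn x))) * indicator (cball 0 1 - {0}) x \<partial>lborel) = ?S"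
      by (intro nn_integral_cong) (auto simp: w_def split: split_indicator)
    moreover have "(\<lambda>\<theta>. ennreal (norm (\<Omega> \<theta>))) \<in> borel_measurable sphere_measure"
      using \<Omega> by measurable
    ultimately show ?thesis by (simp add: nn_integral_sphere_measure)
  qed
  have bound: "norm (kernel_annulus \<Phi> \<Omega> \<gamma> y) \<le> J * (2 * c) ^ DIM('a) * (norm (w y) * indicator (cball 0 (2 / c)) y)"
    for y
  proof (cases "kernel_annulus \<Phi> \<Omega> \<gamma> y = 0")
    case True
    then show ?thesis using J c by (auto split: split_indicator)
  next
    case False
    from kernel_annulus_support[OF supp False]
    have y: "1 / 2 \<le> c * norm y" "c * norm y \<le> 2" by (auto simp: c_def)
    then have y0: "0 < norm y" using c by (smt (verit) mult_nonneg_nonpos half_gt_zero_iff)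
    have "1 / norm y \<le> 2 * c" using y y0 c by (simp add: field_simps)
    then have pw: "(1 / norm y) ^ DIM('a) \<le> (2 * c) ^ DIM('a)" by (intro power_mono) auto
    have "norm (kernel_annulus \<Phi> \<Omega> \<gamma> y) = norm (fourier \<Phi> (c *\<^sub>R y)) * (norm (w y) * (1 / norm y) ^ DIM('a))"
      using y0 by (simp add: kernel_annulus_def rough_kernel_eq_sgn w_def c_def norm_mult norm_divide
          norm_power power_one_over)
    also have "\<dots> \<le> J * (norm (w y) * (2 * c) ^ DIM('a))"
      using norm_fourier_le[of \<Phi>] pw J unfolding J_def by (intro mult_mono mult_left_mono) auto
    also have "\<dots> = J * (2 * c) ^ DIM('a) * (norm (w y) * indicator (cball 0 (2 / c)) y)"
      using y c by (auto simp: field_simps split: split_indicator)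
    finally show ?thesis .
  qed
  have cw: "(\<lambda>y. ennreal (norm (w y)) * indicator (cball 0 (2 / c)) y) \<in> borel_measurable borel"
    by (intro borel_measurable_times_ennreal borel_measurable_indicator) auto
  have "(\<integral>\<^sup>+y. ennreal (norm (kernel_annulus \<Phi> \<Omega> \<gamma> y)) \<partial>lborel)
      \<le> (\<integral>\<^sup>+y. ennreal (J * (2 * c) ^ DIM('a)) * (ennreal (norm (w y)) * indicator (cball 0 (2 / c)) y) \<partial>lborel)"
  proof (rule nn_integral_mono)
    fix y
    show "ennreal (norm (kernel_annulus \<Phi> \<Omega> \<gamma> y))
      \<le> ennreal (J * (2 * c) ^ DIM('a)) * (ennreal (norm (w y)) * indicator (cball 0 (2 / c)) y)"
      using ennreal_leI[OF bound[of y]] J c by (auto simp: ennreal_mult' split: split_indicator)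
  qed
  also have "\<dots> = ennreal (J * (2 * c) ^ DIM('a)) * (\<integral>\<^sup>+y. ennreal (norm (w y)) * indicator (cball 0 (2 / c)) y \<partial>lborel)"
    using cw by (intro nn_integral_cmult) simp
  also have "(\<integral>\<^sup>+y. ennreal (norm (w y)) * indicator (cball 0 (2 / c)) y \<partial>lborel)
      = ennreal ((2 / c) ^ DIM('a)) * (\<integral>\<^sup>+y. ennreal (norm (w ((2/c) *\<^sub>R y))) * indicator (cball 0 (2 / c)) ((2/c) *\<^sub>R y) \<partial>lborel)"
    using nn_integral_lborel_affine[OF cw, of "2/c" 0] c by simp
  also have "(\<integral>\<^sup>+y. ennreal (norm (w ((2/c) *\<^sub>R y))) * indicator (cball 0 (2 / c)) ((2/c) *\<^sub>R y) \<partial>lborel) = ?S"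
  proof (rule nn_integral_cong)
    fix y :: 'a
    have "w ((2 / c) *\<^sub>R y) = w y" using c by (simp add: w_def sgn_scaleR)
    moreover have "(indicator (cball 0 (2 / c)) ((2 / c) *\<^sub>R y) :: ennreal) = indicator (cball 0 1) y"
      using c by (auto simp: indicator_def divide_le_cancel)
    ultimately show "ennreal (norm (w ((2/c) *\<^sub>R y))) * indicator (cball 0 (2 / c)) ((2/c) *\<^sub>R y)
        = ennreal (norm (w y)) * indicator (cball 0 1) y" by simp
  qed
  also have "ennreal (J * (2 * c) ^ DIM('a)) * (ennreal ((2 / c) ^ DIM('a)) * ?S) = ennreal (4 ^ DIM('a) * J) * ?S"
  proof -
    have "J * (2 * c) ^ DIM('a) * (2 / c) ^ DIM('a) = J * (2 * c * (2 / c)) ^ DIM('a)"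
      by (simp only: power_mult_distrib mult.assoc)
    also have "2 * c * (2 / c) = 4" using c by simp
    finally have "ennreal (J * (2 * c) ^ DIM('a)) * ennreal ((2 / c) ^ DIM('a)) = ennreal (4 ^ DIM('a) * J)"
      using c J by (simp add: ennreal_mult'[symmetric] mult.commute)
    then show ?thesis by (simp add: mult.assoc[symmetric])
  qed
  also have "\<dots> \<le> ennreal (4 ^ DIM('a) * J) * (of_nat DIM('a) * ?S)"
  proof (intro mult_left_mono)
    have "1 * ?S \<le> of_nat DIM('a) * ?S"
      by (intro mult_right_mono) (auto simp: Suc_leI)
    then show "?S \<le> of_nat DIM('a) * ?S" by simp
  qed auto
  finally show ?thesis by (simp add: S J_def)
qed

lemma nn_integral_kernel_annulus_moment_le:
  fixes \<Phi> \<Omega> :: "'a::euclidean_space \<Rightarrow> complex"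
  assumes [measurable]: "\<Phi> \<in> borel_measurable borel" and \<Omega>: "\<Omega> \<in> borel_measurable sphere_measure"
    and supp: "\<And>\<xi>. fourier \<Phi> \<xi> \<noteq> 0 \<Longrightarrow> 1/2 \<le> norm \<xi> \<and> norm \<xi> \<le> 2"
  shows "(\<integral>\<^sup>+y. ennreal (norm y * norm (kernel_annulus \<Phi> \<Omega> \<gamma> y)) \<partial>lborel)
    \<le> ennreal (2 / 2 powi \<gamma>) * (\<integral>\<^sup>+y. ennreal (norm (kernel_annulus \<Phi> \<Omega> \<gamma> y)) \<partial>lborel)"
proof -
  note [measurable] = borel_measurable_kernel_annulus[OF assms(1) \<Omega>]
  have "norm y * norm (kernel_annulus \<Phi> \<Omega> \<gamma> y) \<le> 2 / 2 powi \<gamma> * norm (kernel_annulus \<Phi> \<Omega> \<gamma> y)" for y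
  proof (cases "kernel_annulus \<Phi> \<Omega> \<gamma> y = 0")
    case False
    from kernel_annulus_support[OF supp this] show ?thesis
      by (intro mult_right_mono) (auto simp: field_simps)
  qed simp
  then have "(\<integral>\<^sup>+y. ennreal (norm y * norm (kernel_annulus \<Phi> \<Omega> \<gamma> y)) \<partial>lborel)
    \<le> (\<integral>\<^sup>+y. ennreal (2 / 2 powi \<gamma>) * ennreal (norm (kernel_annulus \<Phi> \<Omega> \<gamma> y)) \<partial>lborel)"
    by (intro nn_integral_mono) (auto simp: ennreal_mult'[symmetric] intro!: ennreal_leI)
  also have "\<dots> = ennreal (2 / 2 powi \<gamma>) * (\<integral>\<^sup>+y. ennreal (norm (kernel_annulus \<Phi> \<Omega> \<gamma> y)) \<partial>lborel)"
    by (rule nn_integral_cmult) measurable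
  finally show ?thesis .
qed

lemma borel_measurable_dilate [measurable]:
  fixes \<Phi> :: "'a::euclidean_space \<Rightarrow> complex"
  assumes [measurable]: "\<Phi> \<in> borel_measurable borel"
  shows "dilate j \<Phi> \<in> borel_measurable borel"
  unfolding dilate_def[abs_def] by measurable

lemma nn_integral_dilation:
  fixes G :: "'a::euclidean_space \<Rightarrow> ennreal"
  assumes [measurable]: "G \<in> borel_measurable borel" and c: "0 < c"
  shows "(\<integral>\<^sup>+y. ennreal (c ^ DIM('a)) * G (c *\<^sub>R y) \<partial>lborel) = (\<integral>\<^sup>+y. G y \<partial>lborel)"
  using nn_integral_lborel_affine[of G c 0] c by (simp add: nn_integral_cmult)

lemma norm_dilate:
  "norm (dilate j \<Phi> y) = (2 powi j) ^ DIM('a) * norm (\<Phi> ((2 powi j) *\<^sub>R y))"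
  for y :: "'a::euclidean_space"
  by (simp add: dilate_def norm_mult norm_power norm_power_int)

lemma nn_integral_dilate:
  fixes \<Phi> :: "'a::euclidean_space \<Rightarrow> complex"
  assumes [measurable]: "\<Phi> \<in> borel_measurable borel"
  shows "(\<integral>\<^sup>+y. ennreal (norm (dilate j \<Phi> y)) \<partial>lborel) = (\<integral>\<^sup>+y. ennreal (norm (\<Phi> y)) \<partial>lborel)"
  using nn_integral_dilation[of "\<lambda>y. ennreal (norm (\<Phi> y))" "2 powi j"]
  by (simp add: norm_dilate ennreal_mult')

lemma nn_integral_dilate_moment:
  fixes \<Phi> :: "'a::euclidean_space \<Rightarrow> complex"
  assumes [measurable]: "\<Phi> \<in> borel_measurable borel"
  shows "(\<integral>\<^sup>+y. ennreal (norm y * norm (dilate j \<Phi> y)) \<partial>lborel)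
           = ennreal (1 / 2 powi j) * (\<integral>\<^sup>+y. ennreal (norm y * norm (\<Phi> y)) \<partial>lborel)"
proof -
  define c :: real where "c = 2 powi j"
  have c: "0 < c" by (simp add: c_def)
  have "(\<integral>\<^sup>+y. ennreal (norm y * norm (dilate j \<Phi> y)) \<partial>lborel)
      = (\<integral>\<^sup>+y. ennreal (1 / c) * (ennreal (c ^ DIM('a)) * ennreal (norm (c *\<^sub>R y) * norm (\<Phi> (c *\<^sub>R y)))) \<partial>lborel)"
    using c by (intro nn_integral_cong) (auto simp: norm_dilate c_def[symmetric] ennreal_mult'[symmetric] field_simps)
  also have "\<dots> = ennreal (1 / c) * (\<integral>\<^sup>+y. ennreal (c ^ DIM('a)) * ennreal (norm (c *\<^sub>R y) * norm (\<Phi> (c *\<^sub>R y))) \<partial>lborel)"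
    by (rule nn_integral_cmult) measurable
  also have "(\<integral>\<^sup>+y. ennreal (c ^ DIM('a)) * ennreal (norm (c *\<^sub>R y) * norm (\<Phi> (c *\<^sub>R y))) \<partial>lborel)
      = (\<integral>\<^sup>+y. ennreal (norm y * norm (\<Phi> y)) \<partial>lborel)"
    using nn_integral_dilation[of "\<lambda>y. ennreal (norm y * norm (\<Phi> y))" c] c by simp
  finally show ?thesis by (simp add: c_def)
qed

lemma nn_integral_dilate_translation:
  fixes \<Phi> :: "'a::euclidean_space \<Rightarrow> complex"
  assumes [measurable]: "\<Phi> \<in> borel_measurable borel"
  shows "(\<integral>\<^sup>+y. ennreal (norm (dilate j \<Phi> (y + h) - dilate j \<Phi> y)) \<partial>lborel)
           = (\<integral>\<^sup>+y. ennreal (norm (\<Phi> (y + (2 powi j) *\<^sub>R h) - \<Phi> y)) \<partial>lborel)"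
proof -
  have "norm (dilate j \<Phi> (y + h) - dilate j \<Phi> y)
      = (2 powi j) ^ DIM('a) * norm (\<Phi> ((2 powi j) *\<^sub>R y + (2 powi j) *\<^sub>R h) - \<Phi> ((2 powi j) *\<^sub>R y))" for y
    by (simp add: dilate_def norm_mult norm_power norm_power_int scaleR_add_right right_diff_distrib[symmetric])
  then show ?thesis
    using nn_integral_dilation[of "\<lambda>y. ennreal (norm (\<Phi> (y + (2 powi j) *\<^sub>R h) - \<Phi> y))" "2 powi j"]
    by (simp add: ennreal_mult')
qed

text \<open>A kernel concentrated at distance \<open>1 / s\<close> from the origin, smooth at scale \<open>1
  / t\<close>, of mean zero, with size \<open>B\<close> in \<open>L\<^sup>1\<close>. The clauses
  are exactly what the convolution estimates below consume.\<close>

definition localized_kernel :: "real \<Rightarrow> real \<Rightarrow> real \<Rightarrow> ('a::euclidean_space \<Rightarrow> complex) \<Rightarrow> bool" where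
  "localized_kernel B s t K \<longleftrightarrow>
     integrable lborel K \<and>
     (\<integral>\<^sup>+y. ennreal (norm (K y)) \<partial>lborel) \<le> ennreal B \<and>
     (\<integral>\<^sup>+y. ennreal (norm y * norm (K y)) \<partial>lborel) \<le> ennreal (B / s) \<and>
     (\<forall>h. (\<integral>\<^sup>+y. ennreal (norm (K (y + h) - K y)) \<partial>lborel) \<le> ennreal (B * t * norm h)) \<and>
     (\<forall>y. norm (K y) \<le> B * t ^ DIM('a)) \<and>
     (LINT y|lborel. K y) = 0"

text \<open>Size comes from the annular factor, and smoothness, the supremum bound and the vanishing
  integral from the dilated Schwartz factor: its Fourier transform is \<open>0\<close> at the
  origin. In the first moment, the Schwartz factor contributes
  \<open>2^-(\<mu>+\<gamma>)\<close>, and \<open>\<mu> \<ge> 0\<close> makes it no larger than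
  \<open>2^-\<gamma>\<close>.\<close>

lemma kernel_piece_localized:
  fixes \<Phi> :: "'a::euclidean_space \<Rightarrow> complex"
  assumes \<Phi>: "schwartz \<Phi>"
    and supp: "\<And>\<xi>. fourier \<Phi> \<xi> \<noteq> 0 \<Longrightarrow> 1/2 \<le> norm \<xi> \<and> norm \<xi> \<le> 2"
    and q: "1 \<le> q"
  obtains A where "0 < A"
    "\<And>\<mu> \<gamma> \<Omega>. 0 \<le> \<mu> \<Longrightarrow> \<Omega> \<in> Lp_space sphere_measure q \<Longrightarrow>
       localized_kernel (A * enn2real (Lp_norm sphere_measure q \<Omega>))
         (2 powi \<gamma>) (2 powi (\<mu> + \<gamma>)) (kernel_piece \<Phi> \<Omega> \<mu> \<gamma>)"
proof -
  note [measurable] = schwartz_measurable[OF \<Phi>]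
  define J0 where "J0 = (LINT x|lborel. norm (\<Phi> x))"
  define J1 where "J1 = (LINT x|lborel. norm x * norm (\<Phi> x))"
  have J: "0 \<le> J0" "0 \<le> J1" by (auto simp: J0_def J1_def)
  have J0: "(\<integral>\<^sup>+x. ennreal (norm (\<Phi> x)) \<partial>lborel) = ennreal J0"
    unfolding J0_def by (rule nn_integral_eq_integral) (auto intro: schwartz_integrable[OF \<Phi>])
  have "integrable lborel (\<lambda>x. norm x * norm (\<Phi> x))"
    by (rule Bochner_Integration.integrable_bound[OF schwartz_integrable_moment[OF \<Phi>]])
       (auto simp: abs_mult algebra_simps)
  then have J1: "(\<integral>\<^sup>+x. ennreal (norm x * norm (\<Phi> x)) \<partial>lborel) = ennreal J1"
    unfolding J1_def by (rule nn_integral_eq_integral) auto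
  obtain M where M: "0 \<le> M" "\<And>x. norm (\<Phi> x) \<le> M" using schwartz_bounded[OF \<Phi>] by auto
  obtain T where T: "0 \<le> T"
    "\<And>h. (\<integral>\<^sup>+x. ennreal (norm (\<Phi> (x + h) - \<Phi> x)) \<partial>lborel) \<le> ennreal (T * norm h)"
    using schwartz_translation_L1[OF \<Phi>] by auto
  define \<Sigma> where "\<Sigma> = enn2real (1 + emeasure sphere_measure (space (sphere_measure :: 'a measure)))"
  have \<Sigma>: "1 + emeasure sphere_measure (space (sphere_measure :: 'a measure)) = ennreal \<Sigma>"
    using emeasure_sphere_measure_finite[where 'a='a] by (simp add: \<Sigma>_def less_top)
  have \<Sigma>0: "0 \<le> \<Sigma>" by (simp add: \<Sigma>_def)
  define a where "a = 4 ^ DIM('a) * J0 * \<Sigma>"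
  have a: "0 \<le> a" using J \<Sigma>0 by (simp add: a_def)
  \<comment> \<open>The summands dominate the constants of the size, first moment, smoothness and supremum bounds.\<close>
  define A where "A = 1 + (J0 + (J1 + 2 * J0) + T + M) * a"
  have "localized_kernel (A * enn2real (Lp_norm sphere_measure q \<Omega>))
         (2 powi \<gamma>) (2 powi (\<mu> + \<gamma>)) (kernel_piece \<Phi> \<Omega> \<mu> \<gamma>)"
    if \<mu>: "0 \<le> \<mu>" and \<Omega>: "\<Omega> \<in> Lp_space sphere_measure q" for \<mu> \<gamma> \<Omega>
  proof -
    define N where "N = enn2real (Lp_norm sphere_measure q \<Omega>)"
    have N: "Lp_norm sphere_measure q \<Omega> = ennreal N" "0 \<le> N"
      using \<Omega> by (auto simp: N_def Lp_space_def)
    have \<Omega>m: "\<Omega> \<in> borel_measurable sphere_measure" using \<Omega> by (simp add: Lp_space_def)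
    note [measurable] = borel_measurable_kernel_annulus[OF schwartz_measurable[OF \<Phi>] \<Omega>m]
    define k where "k = kernel_annulus \<Phi> \<Omega> \<gamma>"
    define \<phi> where "\<phi> = dilate (\<mu> + \<gamma>) \<Phi>"
    have [measurable]: "k \<in> borel_measurable borel" "\<phi> \<in> borel_measurable borel"
      by (auto simp: k_def \<phi>_def)
    have K: "kernel_piece \<Phi> \<Omega> \<mu> \<gamma> = convolution \<phi> k"
      by (simp add: kernel_piece_def k_def \<phi>_def)
    define s t :: real where "s = 2 powi \<gamma>" and "t = 2 powi (\<mu> + \<gamma>)"
    have s: "0 < s" and st: "s \<le> t" using \<mu> by (auto simp: s_def t_def intro!: power_int_increasing)
    have "(\<integral>\<^sup>+y. ennreal (norm (k y)) \<partial>lborel) \<le> ennreal (4 ^ DIM('a) * J0) * (ennreal \<Sigma> * ennreal N)"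
      using nn_integral_kernel_annulus_le[OF schwartz_measurable[OF \<Phi>] \<Omega>m supp, of \<gamma>]
        mult_left_mono[OF nn_integral_le_Lp_norm[OF q \<Omega>m], of "ennreal (4 ^ DIM('a) * J0)"]
      unfolding k_def J0_def[symmetric] \<Sigma> N(1) by (meson order_trans zero_le)
    also have "\<dots> = ennreal (a * N)"
      using J \<Sigma>0 N(2) by (simp add: a_def ennreal_mult'[symmetric] mult_ac)
    finally have k0: "(\<integral>\<^sup>+y. ennreal (norm (k y)) \<partial>lborel) \<le> ennreal (a * N)" .
    have "(\<integral>\<^sup>+y. ennreal (norm y * norm (k y)) \<partial>lborel) \<le> ennreal (2 / s) * ennreal (a * N)"
      using nn_integral_kernel_annulus_moment_le[OF schwartz_measurable[OF \<Phi>] \<Omega>m supp, of \<gamma>]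
        mult_left_mono[OF k0, of "ennreal (2 / s)"]
      unfolding k_def s_def by (meson order_trans zero_le)
    also have "\<dots> = ennreal (2 * a * N / s)" using s a N by (simp add: ennreal_mult'[symmetric])
    finally have k1: "(\<integral>\<^sup>+y. ennreal (norm y * norm (k y)) \<partial>lborel) \<le> ennreal (2 * a * N / s)" .
    have \<phi>0: "(\<integral>\<^sup>+y. ennreal (norm (\<phi> y)) \<partial>lborel) = ennreal J0"
      unfolding \<phi>_def by (simp add: nn_integral_dilate J0)
    have \<phi>1: "(\<integral>\<^sup>+y. ennreal (norm y * norm (\<phi> y)) \<partial>lborel) = ennreal (J1 / t)"
      unfolding \<phi>_def using J by (simp add: nn_integral_dilate_moment J1 t_def ennreal_mult'[symmetric])
    have kint: "integrable lborel k"
      using k0 by (auto simp: integrable_iff_bounded le_less_trans)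
    have \<phi>int: "integrable lborel \<phi>"
      using \<phi>0 by (auto simp: integrable_iff_bounded)
    have kint_le: "(LINT y|lborel. norm (k y)) \<le> a * N"
      using k0 kint a N(2) nn_integral_eq_integral[of lborel "\<lambda>y. norm (k y)"] by simp
    have le_A: "x * (a * N) \<le> A * N" if "x \<le> J0 + (J1 + 2 * J0) + T + M" for x
    proof -
      have "x * (a * N) \<le> (J0 + (J1 + 2 * J0) + T + M) * (a * N)"
        using that a N by (intro mult_right_mono) auto
      also have "\<dots> \<le> A * N" using N by (simp add: A_def algebra_simps)
      finally show ?thesis .
    qed
    have b0: "(\<integral>\<^sup>+y. ennreal (norm (convolution \<phi> k y)) \<partial>lborel) \<le> ennreal (A * N)"
    proof -
      have "(\<integral>\<^sup>+y. ennreal (norm (convolution \<phi> k y)) \<partial>lborel) \<le> ennreal J0 * ennreal (a * N)"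
        using nn_integral_norm_convolution_le[of \<phi> k] mult_left_mono[OF k0, of "ennreal J0"]
        by (auto simp: \<phi>0)
      also have "\<dots> \<le> ennreal (A * N)"
        using le_A[of J0] J T M by (simp add: ennreal_mult'[symmetric] ennreal_leI)
      finally show ?thesis .
    qed
    have b1: "(\<integral>\<^sup>+y. ennreal (norm y * norm (convolution \<phi> k y)) \<partial>lborel) \<le> ennreal (A * N / s)"
    proof -
      have "(\<integral>\<^sup>+y. ennreal (norm y * norm (convolution \<phi> k y)) \<partial>lborel)
          \<le> ennreal (J1 / t) * ennreal (a * N) + ennreal J0 * ennreal (2 * a * N / s)"
        using nn_integral_moment_convolution_le[of \<phi> k]
          add_mono[OF mult_left_mono[OF k0, of "ennreal (J1 / t)"] mult_left_mono[OF k1, of "ennreal J0"]]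
        by (auto simp: \<phi>0 \<phi>1)
      also have "\<dots> = ennreal (J1 / t * (a * N) + J0 * (2 * a * N / s))"
        using J a N s st by (simp add: ennreal_mult'[symmetric] ennreal_plus[symmetric] del: ennreal_plus)
      also have "\<dots> \<le> ennreal (A * N / s)"
      proof (rule ennreal_leI)
        have "J1 / t * (a * N) \<le> J1 / s * (a * N)"
          using J a N s st by (intro mult_right_mono divide_left_mono) auto
        then have "J1 / t * (a * N) + J0 * (2 * a * N / s) \<le> (J1 + 2 * J0) * (a * N) / s"
          by (simp add: algebra_simps add_divide_distrib)
        also have "\<dots> \<le> A * N / s"
          using le_A[of "J1 + 2 * J0"] J T M s by (intro divide_right_mono) auto
        finally show "J1 / t * (a * N) + J0 * (2 * a * N / s) \<le> A * N / s" .
      qed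
      finally show ?thesis .
    qed
    \<comment> \<open>Boundedness of the Schwartz factor makes the convolution converge at every point.\<close>
    have bd: "norm (\<phi> z) \<le> t ^ DIM('a) * M" for z
      using M(2) s st unfolding \<phi>_def norm_dilate t_def[symmetric] by (intro mult_left_mono) auto
    have b3: "norm (convolution \<phi> k y) \<le> A * N * t ^ DIM('a)" for y
    proof -
      have "norm (convolution \<phi> k y) \<le> (t ^ DIM('a) * M) * (LINT y|lborel. norm (k y))"
        by (rule norm_convolution_le_sup[OF bd kint])
      also have "\<dots> \<le> (t ^ DIM('a) * M) * (a * N)"
        using kint_le M s st by (intro mult_left_mono) auto
      also have "\<dots> = t ^ DIM('a) * (M * (a * N))" by (simp add: mult_ac)
      also have "\<dots> \<le> t ^ DIM('a) * (A * N)"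
        using le_A[of M] J T M s st by (intro mult_left_mono) auto
      finally show ?thesis by (simp add: mult_ac)
    qed
    have b2: "(\<integral>\<^sup>+y. ennreal (norm (convolution \<phi> k (y + h) - convolution \<phi> k y)) \<partial>lborel)
        \<le> ennreal (A * N * t * norm h)" for h
    proof -
      have "convolution \<phi> k (y + h) - convolution \<phi> k y = convolution (\<lambda>x. \<phi> (x + h) - \<phi> x) k y" for y
      proof -
        have "integrable lborel (\<lambda>z. \<phi> (y' - z) * k z)" for y'
          by (rule integrable_bounded_mult[OF _ bd kint]) measurable
        from this[of "y + h"] this[of y] show ?thesis
          by (simp add: convolution_def left_diff_distrib add_diff_eq diff_add_eq)
      qed
      then have "(\<integral>\<^sup>+y. ennreal (norm (convolution \<phi> k (y + h) - convolution \<phi> k y)) \<partial>lborel)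
         = (\<integral>\<^sup>+y. ennreal (norm (convolution (\<lambda>x. \<phi> (x + h) - \<phi> x) k y)) \<partial>lborel)" by simp
      also have "\<dots> \<le> (\<integral>\<^sup>+y. ennreal (norm (\<phi> (y + h) - \<phi> y)) \<partial>lborel) * (\<integral>\<^sup>+y. ennreal (norm (k y)) \<partial>lborel)"
        by (rule nn_integral_norm_convolution_le) measurable
      also have "\<dots> \<le> ennreal (T * norm (t *\<^sub>R h)) * ennreal (a * N)"
        unfolding \<phi>_def nn_integral_dilate_translation[OF schwartz_measurable[OF \<Phi>]] t_def
        by (intro mult_mono T k0) auto
      also have "\<dots> = ennreal (T * (a * N) * (t * norm h))"
        using s st a N T(1) by (simp add: ennreal_mult'[symmetric] mult_ac)
      also have "\<dots> \<le> ennreal (A * N * (t * norm h))"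
        using le_A[of T] J T M s st by (intro ennreal_leI mult_right_mono) auto
      finally show ?thesis by (simp add: mult_ac)
    qed
    have "fourier \<Phi> 0 = 0" using supp[of 0] by auto
    then have "(LINT y|lborel. \<phi> y) = 0"
      using fourier_dilate[of \<Phi> "\<mu> + \<gamma>" 0] by (simp add: fourier_0[symmetric] \<phi>_def)
    then have b4: "(LINT y|lborel. convolution \<phi> k y) = 0"
      by (simp add: integral_convolution[OF \<phi>int kint])
    have "integrable lborel (convolution \<phi> k)"
      using b0 by (auto simp: integrable_iff_bounded le_less_trans)
    then show ?thesis
      unfolding localized_kernel_def K N_def[symmetric] s_def[symmetric] t_def[symmetric]
      using b0 b1 b2 b3 b4 by auto
  qed
  moreover have "0 < A"
    unfolding A_def using a J T M by (intro add_pos_nonneg mult_nonneg_nonneg) auto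
  ultimately show ?thesis using that by blast
qed

section \<open>Convolution with a localized kernel\<close>

lemma ennreal_norm_integral_le:
  fixes f :: "'a \<Rightarrow> complex"
  shows "ennreal (norm (integral\<^sup>L M f)) \<le> (\<integral>\<^sup>+x. ennreal (norm (f x)) \<partial>M)"
  by (cases "integrable M f") (auto simp: integral_norm_bound_ennreal not_integrable_integral_eq)

lemma localized_kernel_integrable: "localized_kernel B s t K \<Longrightarrow> integrable lborel K"
  by (simp add: localized_kernel_def)

lemma localized_kernel_measurable: "localized_kernel B s t K \<Longrightarrow> K \<in> borel_measurable borel"
  using borel_measurable_integrable[OF localized_kernel_integrable] by simp

lemma localized_kernel_L1:
  assumes "localized_kernel B s t K" "0 \<le> B"
  shows "(LINT y|lborel. norm (K y)) \<le> B"
proof -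
  have i: "integrable lborel (\<lambda>y. norm (K y))"
    using localized_kernel_integrable[OF assms(1)] by simp
  have "(\<integral>\<^sup>+y. ennreal (norm (K y)) \<partial>lborel) \<le> ennreal B"
    using assms(1) by (simp add: localized_kernel_def)
  then show ?thesis using assms(2) nn_integral_eq_integral[OF i] by simp
qed

text \<open>The gain at small spatial scales: a factor vanishing linearly at the origin costs only the first
  moment of the kernel. It serves for both \<open>H z = F (p - z) - F p\<close> and the Gaussian
  multiplier.\<close>

lemma localized_kernel_first_order:
  fixes H :: "'a::euclidean_space \<Rightarrow> complex"
  assumes K: "localized_kernel B s t K" and pos: "0 \<le> B" "0 < s" "0 \<le> D"
    and H: "\<And>z. norm (H z) \<le> D * norm z"
  shows "norm (LINT z|lborel. H z * K z) \<le> D * B / s"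
proof -
  note [measurable] = localized_kernel_measurable[OF K]
  have "ennreal (norm (LINT z|lborel. H z * K z)) \<le> (\<integral>\<^sup>+z. ennreal (norm (H z * K z)) \<partial>lborel)"
    by (rule ennreal_norm_integral_le)
  also have "\<dots> \<le> (\<integral>\<^sup>+z. ennreal D * ennreal (norm z * norm (K z)) \<partial>lborel)"
  proof (rule nn_integral_mono)
    fix z
    have "norm (H z * K z) \<le> D * (norm z * norm (K z))"
      using mult_right_mono[OF H, of "norm (K z)" z] by (simp add: norm_mult mult_ac)
    then show "ennreal (norm (H z * K z)) \<le> ennreal D * ennreal (norm z * norm (K z))"
      using pos by (simp add: ennreal_mult'[symmetric] ennreal_leI)
  qed
  also have "\<dots> = ennreal D * (\<integral>\<^sup>+z. ennreal (norm z * norm (K z)) \<partial>lborel)"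
    by (rule nn_integral_cmult) measurable
  also have "\<dots> \<le> ennreal D * ennreal (B / s)"
    using K by (intro mult_left_mono) (auto simp: localized_kernel_def)
  also have "\<dots> = ennreal (D * B / s)" using pos by (simp add: ennreal_mult'[symmetric])
  finally show ?thesis using pos by (subst (asm) ennreal_le_iff) auto
qed

lemma convolution_localized_bounded:
  assumes K: "localized_kernel B s t K" and B: "0 \<le> B" and F: "\<And>z. norm (F z) \<le> M"
  shows "norm (convolution F K p) \<le> M * B"
proof -
  have M: "0 \<le> M" using F[of undefined] norm_ge_zero by (rule order_trans[rotated])
  show ?thesis
    using norm_convolution_le_sup[of F M, OF F localized_kernel_integrable[OF K], where y=p]
      mult_left_mono[OF localized_kernel_L1[OF K B] M] by linarith
qed

text \<open>The gain at low frequencies: for integrable \<open>F\<close>, use the supremum bound of the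
  kernel.\<close>

lemma convolution_localized_integrable:
  fixes F :: "'a::euclidean_space \<Rightarrow> complex"
  assumes K: "localized_kernel B s t K" and F: "integrable lborel F"
  shows "norm (convolution F K p) \<le> B * t ^ DIM('a) * (LINT z|lborel. norm (F z))"
proof -
  have "convolution F K p = convolution K F p"
    using localized_kernel_measurable[OF K] F by (intro convolution_commute) auto
  moreover have "norm (K z) \<le> B * t ^ DIM('a)" for z
    using K by (simp add: localized_kernel_def)
  ultimately show ?thesis using norm_convolution_le_sup[OF _ F, of K "B * t ^ DIM('a)" p] by simp
qed

text \<open>Moving the translation onto the kernel turns the oscillation of the convolution into the
  \<open>L\<^sup>1\<close> modulus of continuity of the kernel, so \<open>F\<close> need only be
  bounded.\<close>

lemma convolution_localized_oscillation:
  fixes F :: "'a::euclidean_space \<Rightarrow> complex"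
  assumes K: "localized_kernel B s t K" and B: "0 \<le> B" "0 \<le> t"
    and [measurable]: "F \<in> borel_measurable borel" and F: "\<And>z. norm (F z) \<le> M"
  shows "norm (convolution F K p - convolution F K p') \<le> M * (B * t * norm (p - p'))"
proof -
  note [measurable] = localized_kernel_measurable[OF K]
  have M: "0 \<le> M" using F[of undefined] norm_ge_zero by (rule order_trans[rotated])
  have int: "integrable lborel (\<lambda>z. K (p - z) * F z)" for p
    using integrable_bounded_mult[OF _ F integrable_lborel_reflect[OF localized_kernel_integrable[OF K], of p]]
    by (simp add: mult.commute)
  have "convolution F K p - convolution F K p' = convolution K F p - convolution K F p'"
    by (simp add: convolution_commute[of F K])
  also have "\<dots> = (LINT z|lborel. (K (p - z) - K (p' - z)) * F z)"
    using int by (simp add: convolution_def left_diff_distrib)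
  finally have "ennreal (norm (convolution F K p - convolution F K p'))
      \<le> (\<integral>\<^sup>+z. ennreal (norm ((K (p - z) - K (p' - z)) * F z)) \<partial>lborel)"
    by (simp only: ennreal_norm_integral_le)
  also have "\<dots> \<le> (\<integral>\<^sup>+z. ennreal M * ennreal (norm (K (p - z) - K (p' - z))) \<partial>lborel)"
  proof (rule nn_integral_mono)
    fix z
    have "norm ((K (p - z) - K (p' - z)) * F z) \<le> M * norm (K (p - z) - K (p' - z))"
      using mult_right_mono[OF F, of "norm (K (p - z) - K (p' - z))" z] by (simp add: norm_mult mult_ac)
    then show "ennreal (norm ((K (p - z) - K (p' - z)) * F z)) \<le> ennreal M * ennreal (norm (K (p - z) - K (p' - z)))"
      using M by (simp add: ennreal_mult'[symmetric] ennreal_leI)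
  qed
  also have "\<dots> = ennreal M * (\<integral>\<^sup>+z. ennreal (norm (K (p - z) - K (p' - z))) \<partial>lborel)"
    by (rule nn_integral_cmult) measurable
  also have "(\<integral>\<^sup>+z. ennreal (norm (K (p - z) - K (p' - z))) \<partial>lborel)
      = (\<integral>\<^sup>+z. ennreal (norm (K (z + (p - p')) - K z)) \<partial>lborel)"
    using nn_integral_lborel_reflect[of "\<lambda>z. ennreal (norm (K (z + (p - p')) - K z))" p']
    by (simp add: algebra_simps)
  also have "ennreal M * \<dots> \<le> ennreal M * ennreal (B * t * norm (p - p'))"
    using K by (intro mult_left_mono) (auto simp: localized_kernel_def)
  also have "\<dots> = ennreal (M * (B * t * norm (p - p')))" using M B by (simp add: ennreal_mult'[symmetric])
  finally show ?thesis using M B by (subst (asm) ennreal_le_iff) auto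
qed

text \<open>Since the kernel has mean zero, \<open>F p\<close> can be subtracted from \<open>F (p -
  z)\<close>.\<close>

lemma convolution_localized_lipschitz:
  fixes F :: "'a::euclidean_space \<Rightarrow> complex"
  assumes K: "localized_kernel B s t K" and pos: "0 \<le> B" "0 < s" "0 \<le> \<Lambda>"
    and [measurable]: "F \<in> borel_measurable borel" and F: "\<And>z. norm (F z) \<le> M"
    and lip: "\<And>y z. norm (F y - F z) \<le> \<Lambda> * norm (y - z)"
  shows "norm (convolution F K p) \<le> \<Lambda> * B / s"
proof -
  have "integrable lborel (\<lambda>z. F (p - z) * K z)"
    by (rule integrable_bounded_mult[OF _ F localized_kernel_integrable[OF K]]) measurable
  moreover have "integrable lborel (\<lambda>z. F p * K z)"
    using localized_kernel_integrable[OF K] by simp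
  ultimately have "(LINT z|lborel. (F (p - z) - F p) * K z)
      = convolution F K p - F p * (LINT z|lborel. K z)"
    by (simp add: convolution_def left_diff_distrib)
  then have "convolution F K p = (LINT z|lborel. (F (p - z) - F p) * K z)"
    using K by (simp add: localized_kernel_def)
  also have "norm \<dots> \<le> \<Lambda> * B / s"
  proof (rule localized_kernel_first_order[OF K pos])
    show "norm (F (p - z) - F p) \<le> \<Lambda> * norm z" for z using lip[of "p - z" p] by simp
  qed
  finally show ?thesis .
qed

text \<open>Dividing by the Gaussian at \<open>p\<close> normalises the multiplier to \<open>1 - E (p - z) /
  E p\<close>, which vanishes at \<open>z = 0\<close>. The regularity is taken from the Gaussian
  alone, because the final bound must see \<open>F\<close> only through its supremum.\<close>

lemma convolution_localized_gaussian_commutator: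
  fixes F :: "'a::euclidean_space \<Rightarrow> complex"
  assumes K: "localized_kernel B s t K" and pos: "0 \<le> B" "0 < s" "0 < l"
    and [measurable]: "F \<in> borel_measurable borel" and F: "\<And>z. norm (F z) \<le> M"
  shows "norm (convolution F K p
      - convolution (\<lambda>z. F z * complex_of_real (gaussian c l z)) K p / complex_of_real (gaussian c l p))
    \<le> M / (gaussian c l p * l) * B / s"
proof -
  let ?E = "gaussian c l"
  have M: "0 \<le> M" using F[of undefined] norm_ge_zero by (rule order_trans[rotated])
  have E: "0 < ?E p" by (rule gaussian_pos)
  have FE: "norm (F z * complex_of_real (?E z)) \<le> M" for z
    using mult_mono[OF F[of z] gaussian_le_1[of c l z] M] gaussian_pos[of c l z] by (simp add: norm_mult)
  have "integrable lborel (\<lambda>z. F (p - z) * K z)"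
    by (rule integrable_bounded_mult[OF _ F localized_kernel_integrable[OF K]]) measurable
  moreover have "integrable lborel (\<lambda>z. F (p - z) * complex_of_real (?E (p - z)) * K z)"
    by (rule integrable_bounded_mult[OF _ FE localized_kernel_integrable[OF K]]) measurable
  then have "integrable lborel (\<lambda>z. F (p - z) * complex_of_real (?E (p - z)) * K z / complex_of_real (?E p))"
    by simp
  ultimately have "(LINT z|lborel. F (p - z) * K z - F (p - z) * complex_of_real (?E (p - z)) * K z / complex_of_real (?E p))
     = convolution F K p - convolution (\<lambda>z. F z * complex_of_real (?E z)) K p / complex_of_real (?E p)"
    by (subst Bochner_Integration.integral_diff) (auto simp: convolution_def)
  moreover have "F (p - z) * K z - F (p - z) * complex_of_real (?E (p - z)) * K z / complex_of_real (?E p)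
     = (F (p - z) * complex_of_real ((?E p - ?E (p - z)) / ?E p)) * K z" for z
    using E by (simp add: field_simps)
  ultimately have "convolution F K p - convolution (\<lambda>z. F z * complex_of_real (?E z)) K p / complex_of_real (?E p)
     = (LINT z|lborel. (F (p - z) * complex_of_real ((?E p - ?E (p - z)) / ?E p)) * K z)" by simp
  also have "norm \<dots> \<le> M / (?E p * l) * B / s"
  proof (rule localized_kernel_first_order[OF K pos(1,2)])
    show "0 \<le> M / (?E p * l)" using M E pos by simp
    show "norm (F (p - z) * complex_of_real ((?E p - ?E (p - z)) / ?E p)) \<le> M / (?E p * l) * norm z" for z
    proof -
      have "\<bar>?E p - ?E (p - z)\<bar> / ?E p \<le> norm z / l / ?E p"
        using gaussian_lipschitz[OF pos(3), of c p "p - z"] E by (intro divide_right_mono) auto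
      then have "norm (F (p - z)) * (\<bar>?E p - ?E (p - z)\<bar> / ?E p) \<le> M * (norm z / l / ?E p)"
        using E M by (intro mult_mono F) auto
      also have "\<dots> = M / (?E p * l) * norm z" by (simp add: field_simps)
      finally show ?thesis using E by (simp only: norm_mult norm_of_real abs_divide abs_of_pos)
    qed
  qed
  finally show ?thesis .
qed

section \<open>Summation over the scales\<close>

text \<open>Here \<open>k\<close> is the scale \<open>\<gamma>\<close> relative to that of the cube. The
  three branches are the sizes of the contributions in the three regimes: fine scales, the
  \<open>\<mu>\<close> intermediate ones, and coarse scales.\<close>

definition scale_weight :: "int \<Rightarrow> int \<Rightarrow> real" where
  "scale_weight \<mu> k = (if 0 < k then 2 powi (- k) else if - \<mu> < k then 1 else 2 powi (\<mu> + k))"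

lemma has_sum_scale_weight:
  assumes "0 \<le> \<mu>"
  shows "(scale_weight \<mu> has_sum (of_int \<mu> + 3)) UNIV"
proof -
  have geo: "((\<lambda>n. (1/2::real) ^ n) has_sum 2) UNIV"
    using geometric_sums[of "1/2::real"] by (intro norm_summable_imp_has_sum) auto
  have p: "2 powi (- int n) = (1/2::real) ^ n" for n
    by (simp add: power_int_minus power_one_over inverse_eq_divide)
  have "((scale_weight \<mu> \<circ> (\<lambda>n::nat. 1 + int n)) has_sum (1/2) * 2) UNIV"
  proof -
    have "scale_weight \<mu> \<circ> (\<lambda>n::nat. 1 + int n) = (\<lambda>n. (1/2) * (1/2) ^ n)"
    proof
      fix n
      show "(scale_weight \<mu> \<circ> (\<lambda>n::nat. 1 + int n)) n = (1/2) * (1/2) ^ n"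
        using p[of "Suc n"] by (simp add: scale_weight_def)
    qed
    then show ?thesis using has_sum_cmult_right[OF geo, of "1/2"] by simp
  qed
  then have "(scale_weight \<mu> has_sum 1) ((\<lambda>n::nat. 1 + int n) ` UNIV)"
    by (subst has_sum_reindex) (auto simp: inj_on_def)
  also have "(\<lambda>n::nat. 1 + int n) ` UNIV = {0<..}"
  proof (intro equalityI subsetI)
    fix k :: int assume "k \<in> {0<..}"
    then have "k = 1 + int (nat (k - 1))" by simp
    then show "k \<in> range (\<lambda>n. 1 + int n)" by blast
  qed auto
  finally have 1: "(scale_weight \<mu> has_sum 1) {0<..}" .
  have "((scale_weight \<mu> \<circ> (\<lambda>n::nat. - \<mu> - int n)) has_sum 2) UNIV"
  proof -
    have "scale_weight \<mu> \<circ> (\<lambda>n::nat. - \<mu> - int n) = (\<lambda>n. (1/2) ^ n)"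
      using assms p by (auto simp: scale_weight_def fun_eq_iff)
    then show ?thesis using geo by simp
  qed
  then have "(scale_weight \<mu> has_sum 2) ((\<lambda>n::nat. - \<mu> - int n) ` UNIV)"
    by (subst has_sum_reindex) (auto simp: inj_on_def)
  also have "(\<lambda>n::nat. - \<mu> - int n) ` UNIV = {..- \<mu>}"
  proof (intro equalityI subsetI)
    fix k :: int assume "k \<in> {..- \<mu>}"
    then have "k = - \<mu> - int (nat (- \<mu> - k))" by simp
    then show "k \<in> range (\<lambda>n. - \<mu> - int n)" by blast
  qed auto
  finally have 2: "(scale_weight \<mu> has_sum 2) {..- \<mu>}" .
  have "(\<Sum>k\<in>{- \<mu><..0}. scale_weight \<mu> k) = (\<Sum>k\<in>{- \<mu><..0}. 1)"
    by (intro sum.cong) (auto simp: scale_weight_def)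
  then have 3: "(scale_weight \<mu> has_sum of_int \<mu>) {- \<mu><..0}"
    using has_sum_finite[of "{- \<mu><..0}" "scale_weight \<mu>"] assms by simp
  have "(scale_weight \<mu> has_sum (of_int \<mu> + 2 + 1)) (({- \<mu><..0} \<union> {..- \<mu>}) \<union> {0<..})"
    using assms by (intro has_sum_Un_disjoint 1 2 3) auto
  moreover have "({- \<mu><..0} \<union> {..- \<mu>}) \<union> {0<..} = (UNIV :: int set)"
    using assms by auto
  ultimately show ?thesis by (simp add: add.commute)
qed

lemma has_sum_scale_weight_shift:
  assumes "0 \<le> \<mu>"
  shows "((\<lambda>\<gamma>. scale_weight \<mu> (\<gamma> - \<gamma>0)) has_sum (of_int \<mu> + 3)) UNIV"
proof -
  have "bij_betw (\<lambda>\<gamma>. \<gamma> - \<gamma>0) UNIV (UNIV :: int set)"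
    by (rule bij_betwI[where g="\<lambda>k. k + \<gamma>0"]) auto
  from has_sum_reindex_bij_betw[OF this, of "scale_weight \<mu>"] show ?thesis
    using has_sum_scale_weight[OF assms] by simp
qed

lemma exists_dyadic_scale:
  assumes l: "0 < (l::real)"
  obtains \<gamma>0 :: int where "1 \<le> l * 2 powi \<gamma>0" "l * 2 powi \<gamma>0 \<le> 2"
proof
  define k where "k = \<lfloor>log 2 l\<rfloor>"
  have "2 powr (of_int k) \<le> 2 powr (log 2 l)" "2 powr (log 2 l) \<le> 2 powr (of_int k + 1)"
    unfolding k_def by (auto simp: powr_le_cancel_iff intro: less_imp_le)
  then have "2 powi k \<le> l" "l \<le> 2 powi k * 2"
    using l by (auto simp: powr_add powr_real_of_int')
  then show "1 \<le> l * 2 powi (- k)" "l * 2 powi (- k) \<le> 2"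
    by (auto simp: power_int_minus field_simps)
qed

section \<open>Tensor products and Gaussian masses\<close>

definition tensor :: "('a::euclidean_space \<Rightarrow> complex) \<Rightarrow> ('a \<Rightarrow> complex) \<Rightarrow> 'a \<times> 'a \<Rightarrow> complex" where
  "tensor f g z = f (fst z) * g (snd z)"

lemma borel_measurable_tensor [measurable]:
  fixes f g :: "'a::euclidean_space \<Rightarrow> complex"
  assumes [measurable]: "f \<in> borel_measurable borel" "g \<in> borel_measurable borel"
  shows "tensor f g \<in> borel_measurable borel"
proof -
  have [measurable]: "fst \<in> borel_measurable (borel :: ('a \<times> 'a) measure)"
    "snd \<in> borel_measurable (borel :: ('a \<times> 'a) measure)"
    by (intro borel_measurable_continuous_onI continuous_intros)+
  show ?thesis unfolding tensor_def[abs_def] by measurable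
qed

lemma norm_tensor_le:
  assumes "\<And>x. norm (f x) \<le> a" "\<And>x. norm (g x) \<le> b"
  shows "norm (tensor f g z) \<le> a * b"
  unfolding tensor_def norm_mult
  by (intro mult_mono assms norm_ge_zero order_trans[OF norm_ge_zero assms(1)])

lemma integrable_tensor:
  fixes f g :: "'a::euclidean_space \<Rightarrow> complex"
  assumes f: "integrable lborel f" and g: "integrable lborel g"
  shows "integrable lborel (tensor f g)"
proof (subst integrable_iff_bounded, safe)
  have [measurable]: "f \<in> borel_measurable borel" "g \<in> borel_measurable borel"
    using f g by auto
  show "tensor f g \<in> borel_measurable lborel" by simp
  have "(\<integral>\<^sup>+z. ennreal (norm (tensor f g z)) \<partial>lborel)
     = (\<integral>\<^sup>+z. ennreal (norm (tensor f g z)) \<partial>(lborel \<Otimes>\<^sub>M lborel))"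
    by (simp add: lborel_prod)
  also have "\<dots> = (\<integral>\<^sup>+x. \<integral>\<^sup>+y. ennreal (norm (f x)) * ennreal (norm (g y)) \<partial>lborel \<partial>lborel)"
    using lborel.nn_integral_fst[of "\<lambda>z. ennreal (norm (tensor f g z))" lborel]
    by (simp add: lborel_prod) (simp add: tensor_def norm_mult ennreal_mult')
  also have "\<dots> = (\<integral>\<^sup>+x. ennreal (norm (f x)) \<partial>lborel) * (\<integral>\<^sup>+y. ennreal (norm (g y)) \<partial>lborel)"
    by (simp add: nn_integral_cmult nn_integral_multc)
  also have "\<dots> < \<infinity>"
    using f g by (auto simp: integrable_iff_bounded ennreal_mult_less_top)
  finally show "(\<integral>\<^sup>+z. ennreal (norm (tensor f g z)) \<partial>lborel) < \<infinity>" .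
qed

lemma tensor_lipschitz:
  fixes f g :: "'a::euclidean_space \<Rightarrow> complex"
  assumes "\<And>x. norm (f x) \<le> a" "\<And>x. norm (g x) \<le> b"
    and f: "\<And>x y. norm (f x - f y) \<le> a' * norm (x - y)"
    and g: "\<And>x y. norm (g x - g y) \<le> b' * norm (x - y)"
    and nn: "0 \<le> a'" "0 \<le> b'"
  shows "norm (tensor f g y - tensor f g z) \<le> (a' * b + a * b') * norm (y - z)"
proof -
  have a: "0 \<le> a" and b: "0 \<le> b" using assms(1,2) norm_ge_zero order_trans by blast+
  have comp: "norm (fst y - fst z) \<le> norm (y - z)" "norm (snd y - snd z) \<le> norm (y - z)"
    by (metis fst_diff norm_fst_le prod.collapse, metis snd_diff norm_snd_le prod.collapse)
  have "tensor f g y - tensor f g z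
      = (f (fst y) - f (fst z)) * g (snd y) + f (fst z) * (g (snd y) - g (snd z))"
    by (simp add: tensor_def algebra_simps)
  also have "norm \<dots> \<le> norm (f (fst y) - f (fst z)) * norm (g (snd y)) 
      + norm (f (fst z)) * norm (g (snd y) - g (snd z))"
    by (metis norm_mult norm_triangle_ineq)
  also have "\<dots> \<le> (a' * norm (fst y - fst z)) * b + a * (b' * norm (snd y - snd z))"
    using nn a by (intro add_mono mult_mono assms) auto
  also have "\<dots> \<le> (a' * norm (y - z)) * b + a * (b' * norm (y - z))"
    using nn a b comp by (intro add_mono mult_left_mono mult_right_mono) auto
  finally show ?thesis by (simp add: algebra_simps)
qed

lemma gaussian_prod: "gaussian (c, c) l z = gaussian c l (fst z) * gaussian c l (snd z)"
proof -
  have "(norm (z - (c, c)))\<^sup>2 = (norm (fst z - c))\<^sup>2 + (norm (snd z - c))\<^sup>2"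
    by (cases z) (simp add: norm_Pair)
  then show ?thesis
    by (simp add: gaussian_def power_divide exp_add[symmetric] add_divide_distrib)
qed

lemma tensor_mult_gaussian:
  "tensor (\<lambda>x. f x * complex_of_real (gaussian c l x)) (\<lambda>x. g x * complex_of_real (gaussian c l x))
     = (\<lambda>z. tensor f g z * complex_of_real (gaussian (c, c) l z))"
  by (simp add: tensor_def gaussian_prod fun_eq_iff)

lemma integrable_gaussian_0_1: "integrable lborel (gaussian (0::'a::euclidean_space) 1)"
proof (rule Bochner_Integration.integrable_bound)
  show "integrable lborel (\<lambda>x::'a. real DIM('a) ^ DIM('a) * decay_weight x)"
    by (intro integrable_mult_right integrable_decay_weight)
  show "AE x in lborel. norm (gaussian (0::'a) 1 x) \<le> norm (real DIM('a) ^ DIM('a) * decay_weight x)"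
    using order_trans[OF gaussian_le_decay_weight abs_ge_self] gaussian_pos[of "0::'a" 1]
    by (auto simp: abs_of_pos)
qed auto

definition gaussian_mass :: "'a::euclidean_space itself \<Rightarrow> real" where
  "gaussian_mass _ = (LINT x|lborel. gaussian (0::'a) 1 x)"

lemma gaussian_mass_nonneg: "0 \<le> gaussian_mass TYPE('a::euclidean_space)"
  unfolding gaussian_mass_def by (intro integral_nonneg_AE) (auto simp: gaussian_pos less_imp_le)

lemma nn_integral_gaussian:
  fixes c :: "'a::euclidean_space"
  assumes l: "0 < l"
  shows "(\<integral>\<^sup>+x. ennreal (gaussian c l x) \<partial>lborel) = ennreal (l ^ DIM('a) * gaussian_mass TYPE('a))"
proof -
  have "(\<integral>\<^sup>+x. ennreal (gaussian c l x) \<partial>lborel)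
     = ennreal (l ^ DIM('a)) * (\<integral>\<^sup>+x. ennreal (gaussian c l (c + l *\<^sub>R x)) \<partial>lborel)"
    using nn_integral_lborel_affine[of "\<lambda>x. ennreal (gaussian c l x)" l c] l by simp
  also have "(\<integral>\<^sup>+x. ennreal (gaussian c l (c + l *\<^sub>R x)) \<partial>lborel) = (\<integral>\<^sup>+x. ennreal (gaussian (0::'a) 1 x) \<partial>lborel)"
    using l by (intro nn_integral_cong) (simp add: gaussian_def)
  also have "\<dots> = ennreal (gaussian_mass TYPE('a))"
    unfolding gaussian_mass_def
    by (rule nn_integral_eq_integral[OF integrable_gaussian_0_1]) (auto simp: gaussian_pos less_imp_le)
  finally show ?thesis using l gaussian_mass_nonneg by (simp add: ennreal_mult'[symmetric])
qed

lemma integral_mult_gaussian_le: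
  fixes F :: "'a::euclidean_space \<Rightarrow> complex"
  assumes [measurable]: "F \<in> borel_measurable borel" and F: "\<And>z. norm (F z) \<le> M" and l: "0 < l"
  shows "integrable lborel (\<lambda>z. F z * complex_of_real (gaussian c l z))"
    and "(LINT z|lborel. norm (F z * complex_of_real (gaussian c l z))) \<le> M * (l ^ DIM('a) * gaussian_mass TYPE('a))"
proof -
  let ?g = "\<lambda>z. F z * complex_of_real (gaussian c l z)"
  have M: "0 \<le> M" using F[of undefined] norm_ge_zero by (rule order_trans[rotated])
  have "(\<integral>\<^sup>+z. ennreal (norm (?g z)) \<partial>lborel) \<le> (\<integral>\<^sup>+z. ennreal M * ennreal (gaussian c l z) \<partial>lborel)"
  proof (rule nn_integral_mono)
    fix z
    have "norm (?g z) \<le> M * gaussian c l z"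
      using mult_right_mono[OF F[of z], of "gaussian c l z"] gaussian_pos[of c l z]
      by (simp add: norm_mult less_imp_le)
    then show "ennreal (norm (?g z)) \<le> ennreal M * ennreal (gaussian c l z)"
      using M by (simp add: ennreal_mult'[symmetric] ennreal_leI)
  qed
  also have "\<dots> = ennreal M * (\<integral>\<^sup>+z. ennreal (gaussian c l z) \<partial>lborel)"
    by (rule nn_integral_cmult) measurable
  also have "\<dots> = ennreal (M * (l ^ DIM('a) * gaussian_mass TYPE('a)))"
    using M by (simp add: nn_integral_gaussian[OF l] ennreal_mult'[symmetric])
  finally have le: "(\<integral>\<^sup>+z. ennreal (norm (?g z)) \<partial>lborel) \<le> ennreal (M * (l ^ DIM('a) * gaussian_mass TYPE('a)))" .
  then show int: "integrable lborel ?g"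
    by (auto simp: integrable_iff_bounded le_less_trans)
  have "(\<integral>\<^sup>+z. ennreal (norm (?g z)) \<partial>lborel) = ennreal (LINT z|lborel. norm (?g z))"
    using int by (intro nn_integral_eq_integral integrable_norm) auto
  then show "(LINT z|lborel. norm (?g z)) \<le> M * (l ^ DIM('a) * gaussian_mass TYPE('a))"
    using le M l gaussian_mass_nonneg[where 'a='a] by simp
qed

section \<open>Comparison with Gaussian-localised data\<close>

definition comparison_const :: "'a::euclidean_space itself \<Rightarrow> real \<Rightarrow> real" where
  "comparison_const _ R = exp (R\<^sup>2) * (1 + 2 ^ DIM('a) * gaussian_mass TYPE('a)) + 2 * R + 1"

lemma comparison_const_nonneg: "0 \<le> R \<Longrightarrow> 0 \<le> comparison_const TYPE('a::euclidean_space) R"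
  unfolding comparison_const_def using gaussian_mass_nonneg[where 'a='a] by simp

lemma gaussian_ge:
  assumes "0 < l" "norm (p - c) \<le> R * l"
  shows "exp (- R\<^sup>2) \<le> gaussian c l p"
proof -
  have "norm (p - c) / l \<le> R" using assms by (simp add: divide_le_eq)
  then have "(norm (p - c) / l)\<^sup>2 \<le> R\<^sup>2" using assms by (intro power_mono) auto
  then show ?thesis by (simp add: gaussian_def)
qed

text \<open>One scale at a time. The term subtracted at coarse scales depends on the centre \<open>c\<close>
  but not on \<open>p\<close>, so that summing it gives the constant from which the mean
  oscillation is measured.\<close>

lemma scale_comparison:
  fixes F :: "'a::euclidean_space \<Rightarrow> complex"
  assumes K: "localized_kernel B (2 powi \<gamma>) (2 powi (\<mu> + \<gamma>)) K" and B: "0 \<le> B" and \<mu>: "0 \<le> \<mu>"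
    and F [measurable]: "F \<in> borel_measurable borel" and bd: "\<And>z. norm (F z) \<le> M"
    and l: "0 < l" and \<gamma>0: "1 \<le> l * 2 powi \<gamma>0" "l * 2 powi \<gamma>0 \<le> 2"
    and R: "0 \<le> R" and p: "norm (p - c) \<le> R * l"
  shows "norm (convolution F K p
      - convolution (\<lambda>z. F z * complex_of_real (gaussian c l z)) K p / complex_of_real (gaussian c l p)
      - (if \<gamma> - \<gamma>0 \<le> - \<mu> then convolution F K c else 0))
    \<le> M * B * comparison_const TYPE('a) R * scale_weight \<mu> (\<gamma> - \<gamma>0)"
    (is "norm (?T - ?U / ?e - ?a) \<le> _")
proof -
  define k where "k = \<gamma> - \<gamma>0"
  define E where "E = gaussian c l p"
  define G where "G = gaussian_mass TYPE('a)"
  define X where "X = exp (R\<^sup>2)"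
  have G: "0 \<le> G" by (simp add: G_def gaussian_mass_nonneg)
  have X: "1 \<le> X" by (simp add: X_def)
  have M: "0 \<le> M" using bd[of undefined] norm_ge_zero by (rule order_trans[rotated])
  have MB: "0 \<le> M * B" using M B by simp
  have E: "0 < E" by (simp add: E_def gaussian_pos)
  have EX: "1 / E \<le> X"
    using gaussian_ge[OF l p] E by (simp add: E_def X_def exp_minus field_simps)
  have FE: "norm (F z * complex_of_real (gaussian c l z)) \<le> M" for z
    using mult_mono[OF bd[of z] gaussian_le_1[of c l z] M] gaussian_pos[of c l z] by (simp add: norm_mult)
  have U_div: "norm (?U / ?e) \<le> norm ?U * X"
  proof -
    have "norm (?U / ?e) = norm ?U * (1 / E)" using E by (simp add: norm_divide E_def[symmetric])
    also have "\<dots> \<le> norm ?U * X" by (intro mult_left_mono EX) auto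
    finally show ?thesis .
  qed
  have C: "comparison_const TYPE('a) R = X * (1 + 2 ^ DIM('a) * G) + 2 * R + 1"
    by (simp add: comparison_const_def X_def G_def)
  have C_ge: "X + 1 \<le> comparison_const TYPE('a) R"
    using X R G by (simp add: C distrib_left)
  consider "0 < k" | "k \<le> 0" "- \<mu> < k" | "k \<le> - \<mu>" by linarith
  then have "norm (?T - ?U / ?e - ?a) \<le> M * B * comparison_const TYPE('a) R * scale_weight \<mu> k"
  proof cases
    case 1
    then have "?a = 0" using \<mu> by (simp add: k_def)
    then have "norm (?T - ?U / ?e - ?a) \<le> M / (E * l) * B / 2 powi \<gamma>"
      using convolution_localized_gaussian_commutator[OF K B _ l F bd, where c=c and p=p] by (simp add: E_def)
    also have "\<dots> = (M * B) * (1 / E) * (1 / (l * 2 powi \<gamma>0) * 2 powi (- k))"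
      using l E by (simp add: k_def power_int_diff power_int_minus field_simps)
    also have "\<dots> \<le> (M * B) * X * (1 * 2 powi (- k))"
      using MB EX E X l \<gamma>0(1) by (intro mult_mono mult_left_mono mult_right_mono) (auto simp: divide_le_eq)
    also have "\<dots> \<le> (M * B) * comparison_const TYPE('a) R * (1 * 2 powi (- k))"
      using MB C_ge by (intro mult_left_mono mult_right_mono) auto
    finally show ?thesis using 1 by (simp add: scale_weight_def)
  next
    case 2
    then have "?a = 0" by (simp add: k_def)
    then have "norm (?T - ?U / ?e - ?a) \<le> norm ?T + norm (?U / ?e)"
      by (simp add: norm_triangle_ineq4)
    also have "\<dots> \<le> M * B + (M * B) * X"
      using convolution_localized_bounded[of B "2 powi \<gamma>" "2 powi (\<mu> + \<gamma>)" K F, OF K B bd]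
        convolution_localized_bounded[OF K B FE, where p=p] X
      by (intro add_mono order_trans[OF U_div] mult_right_mono) auto
    also have "\<dots> \<le> M * B * comparison_const TYPE('a) R"
      using mult_left_mono[OF C_ge MB] by (simp add: algebra_simps)
    finally show ?thesis using 2 by (simp add: scale_weight_def)
  next
    case 3
    define t :: real where "t = 2 powi (\<mu> + \<gamma>)"
    define w :: real where "w = 2 powi (\<mu> + k)"
    have t: "0 < t" by (simp add: t_def)
    have w: "0 < w" "w \<le> 1"
      using 3 power_int_increasing[of "\<mu> + k" 0 "2::real"] by (auto simp: w_def)
    \<comment> \<open>The choice of \<open>\<gamma>0\<close> converts the frequency times the side length into the weight.\<close>
    have "t * l = w * (l * 2 powi \<gamma>0)"
      by (simp add: t_def w_def k_def power_int_add[symmetric])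
    also have "\<dots> \<le> w * 2" using w \<gamma>0 by (intro mult_left_mono) auto
    finally have tl: "t * l \<le> 2 * w" by simp
    have a_eq: "?a = convolution F K c" using 3 by (simp add: k_def)
    have "norm (?T - ?a) \<le> M * (B * t * norm (p - c))"
      unfolding a_eq t_def by (rule convolution_localized_oscillation[OF K B _ F bd]) simp
    also have "\<dots> \<le> M * (B * t * (R * l))"
      using M B t p by (intro mult_left_mono) auto
    also have "\<dots> = M * B * R * (t * l)" by (simp add: mult_ac)
    also have "\<dots> \<le> M * B * R * (2 * w)" using MB R tl by (intro mult_left_mono) auto
    finally have osc: "norm (?T - ?a) \<le> M * B * R * (2 * w)" .
    have "norm ?U \<le> B * t ^ DIM('a) * (LINT z|lborel. norm (F z * complex_of_real (gaussian c l z)))"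
      unfolding t_def by (rule convolution_localized_integrable[OF K integral_mult_gaussian_le(1)[OF F bd l]])
    also have "\<dots> \<le> B * t ^ DIM('a) * (M * (l ^ DIM('a) * G))"
      unfolding G_def using B t by (intro mult_left_mono integral_mult_gaussian_le(2)[OF F bd l]) auto
    also have "\<dots> = M * B * G * (t * l) ^ DIM('a)" by (simp add: power_mult_distrib mult_ac)
    also have "\<dots> \<le> M * B * G * (2 ^ DIM('a) * w)"
    proof (rule mult_left_mono)
      have "(t * l) ^ DIM('a) \<le> (2 * w) ^ DIM('a)" using t l tl by (intro power_mono) auto
      also have "\<dots> = 2 ^ DIM('a) * w ^ DIM('a)" by (rule power_mult_distrib)
      also have "\<dots> \<le> 2 ^ DIM('a) * w ^ 1"
        using w by (intro mult_left_mono power_decreasing) (auto simp: Suc_leI)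
      finally show "(t * l) ^ DIM('a) \<le> 2 ^ DIM('a) * w" by simp
    qed (use MB G in auto)
    finally have U: "norm ?U \<le> M * B * G * (2 ^ DIM('a) * w)" .
    have "norm (?T - ?U / ?e - ?a) = norm ((?T - ?a) - ?U / ?e)" by (simp add: algebra_simps)
    also have "\<dots> \<le> norm (?T - ?a) + norm (?U / ?e)" by (rule norm_triangle_ineq4)
    also have "\<dots> \<le> M * B * R * (2 * w) + M * B * G * (2 ^ DIM('a) * w) * X"
      using osc order_trans[OF U_div mult_right_mono[OF U, of X]] X by (intro add_mono) auto
    also have "\<dots> = M * B * (2 * R + X * (2 ^ DIM('a) * G)) * w" by (simp add: algebra_simps)
    also have "\<dots> \<le> M * B * comparison_const TYPE('a) R * w"
      using MB w X by (intro mult_right_mono mult_left_mono) (auto simp: C distrib_left)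
    finally show ?thesis using 3 \<mu> by (simp add: scale_weight_def w_def)
  qed
  then show ?thesis by (simp add: k_def)
qed

lemma summable_scale_comparison:
  fixes u :: "int \<Rightarrow> complex"
  assumes \<mu>: "0 \<le> \<mu>" and D: "0 \<le> D" and u: "\<And>\<gamma>. norm (u \<gamma>) \<le> D * scale_weight \<mu> (\<gamma> - \<gamma>0)"
  shows "u summable_on UNIV" and "norm (infsum u UNIV) \<le> D * (of_int \<mu> + 3)"
proof -
  have hs: "((\<lambda>\<gamma>. D * scale_weight \<mu> (\<gamma> - \<gamma>0)) has_sum D * (of_int \<mu> + 3)) UNIV"
    by (rule has_sum_cmult_right[OF has_sum_scale_weight_shift[OF \<mu>]])
  have "(\<lambda>\<gamma>. norm (u \<gamma>)) summable_on UNIV"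
    by (rule summable_on_comparison_test[OF has_sum_imp_summable[OF hs]]) (use u in auto)
  then show s: "u summable_on UNIV" by (rule abs_summable_summable)
  show "norm (infsum u UNIV) \<le> D * (of_int \<mu> + 3)"
    by (rule norm_infsum_le[OF has_sum_infsum[OF s] hs]) (use u in auto)
qed

text \<open>At fine scales the regularity of \<open>F\<close> and the mean zero of the kernel give the decay
  \<open>2^-\<gamma>\<close>; at coarse scales the integrability of \<open>F\<close> gives
  \<open>2^(d \<gamma>)\<close>. The bound depends on \<open>F\<close> badly, but it is needed
  only for convergence: a sum that does not converge unconditionally has the default value
  \<open>0\<close> and could not be split.\<close>

lemma summable_multiscale:
  fixes F :: "'a::euclidean_space \<Rightarrow> complex"
  assumes K: "\<And>\<gamma>. localized_kernel B (2 powi \<gamma>) (2 powi (\<mu> + \<gamma>)) (K \<gamma>)" and B: "0 \<le> B"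
    and F: "integrable lborel F" and bd: "\<And>z. norm (F z) \<le> M"
    and lip: "\<And>y z. norm (F y - F z) \<le> \<Lambda> * norm (y - z)" and \<Lambda>: "0 \<le> \<Lambda>"
  shows "(\<lambda>\<gamma>. convolution F (K \<gamma>) p) summable_on UNIV"
proof -
  define I where "I = (LINT z|lborel. norm (F z))"
  have I: "0 \<le> I" by (simp add: I_def)
  \<comment> \<open>The constants of the two regimes, in the order fine, coarse.\<close>
  define D where "D = \<Lambda> * B + B * (2 powi \<mu>) ^ DIM('a) * I"
  have Fm: "F \<in> borel_measurable borel" using F by auto
  show ?thesis
  proof (rule summable_scale_comparison(1)[of 0 D _ 0])
    show "0 \<le> D" using \<Lambda> B I by (simp add: D_def)
    fix \<gamma> :: int
    show "norm (convolution F (K \<gamma>) p) \<le> D * scale_weight 0 (\<gamma> - 0)"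
    proof (cases "0 < \<gamma>")
      case True
      have "norm (convolution F (K \<gamma>) p) \<le> \<Lambda> * B / 2 powi \<gamma>"
        by (rule convolution_localized_lipschitz[OF K B _ \<Lambda> Fm bd lip]) simp
      also have "\<dots> \<le> D / 2 powi \<gamma>"
        using B I by (intro divide_right_mono) (auto simp: D_def)
      finally show ?thesis using True by (simp add: scale_weight_def power_int_minus field_simps)
    next
      case False
      have w: "0 < (2::real) powi \<gamma>" "(2::real) powi \<gamma> \<le> 1"
        using False power_int_increasing[of \<gamma> 0 "2::real"] by auto
      have "norm (convolution F (K \<gamma>) p) \<le> B * (2 powi (\<mu> + \<gamma>)) ^ DIM('a) * I"
        unfolding I_def by (rule convolution_localized_integrable[OF K F])
      also have "\<dots> = B * (2 powi \<mu>) ^ DIM('a) * I * (2 powi \<gamma>) ^ DIM('a)"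
        by (simp add: power_int_add power_mult_distrib mult_ac)
      also have "\<dots> \<le> B * (2 powi \<mu>) ^ DIM('a) * I * (2 powi \<gamma>) ^ 1"
        using w B I by (intro mult_left_mono power_decreasing) (auto simp: Suc_leI)
      also have "\<dots> \<le> D * 2 powi \<gamma>"
        using w \<Lambda> B by (auto simp: D_def intro!: mult_right_mono)
      finally show ?thesis using False by (simp add: scale_weight_def)
    qed
  qed simp
qed

lemma summable_multiscale_schwartz:
  fixes f1 f2 :: "'b::euclidean_space \<Rightarrow> complex"
  assumes K: "\<And>\<gamma>. localized_kernel B (2 powi \<gamma>) (2 powi (\<mu> + \<gamma>)) (K \<gamma>)" and B: "0 \<le> B"
    and f: "schwartz f1" "schwartz f2"
  shows "(\<lambda>\<gamma>. convolution (tensor f1 f2) (K \<gamma>) p) summable_on UNIV"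
proof -
  obtain a b where ab: "\<And>x. norm (f1 x) \<le> a" "\<And>x. norm (f2 x) \<le> b" "0 \<le> a" "0 \<le> b"
    using f by (metis schwartz_bounded)
  obtain a' b' where lip: "\<And>x y. norm (f1 x - f1 y) \<le> a' * norm (x - y)"
      "\<And>x y. norm (f2 x - f2 y) \<le> b' * norm (x - y)" "0 \<le> a'" "0 \<le> b'"
    using f by (metis schwartz_lipschitz)
  show ?thesis
  proof (rule summable_multiscale[OF K B])
    show "integrable lborel (tensor f1 f2)" by (intro integrable_tensor schwartz_integrable f)
    show "norm (tensor f1 f2 z) \<le> a * b" for z by (rule norm_tensor_le[OF ab(1,2)])
    show "norm (tensor f1 f2 y - tensor f1 f2 z) \<le> (a' * b + a * b') * norm (y - z)" for y z
      by (rule tensor_lipschitz[OF ab(1,2) lip])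
    show "0 \<le> a' * b + a * b'" using ab lip by simp
  qed
qed

section \<open>The bilinear operator on cubes\<close>

lemma bilinear_op_eq_infsum:
  fixes f1 f2 :: "real^'n \<Rightarrow> complex"
  shows "bilinear_op \<Phi> \<Omega> \<mu> f1 f2 x
     = (\<Sum>\<^sub>\<infinity>\<gamma>\<in>UNIV. convolution (tensor f1 f2) (kernel_piece \<Phi> \<Omega> \<mu> \<gamma>) (x, x))"
  unfolding bilinear_op_def convolution_def tensor_def
  by (intro infsum_cong Bochner_Integration.integral_cong) (auto simp: mult_ac)

text \<open>The sum over all integers is the pointwise limit of the sums over \<open>{-n..n}\<close>.\<close>

lemma borel_measurable_infsum_int:
  fixes u :: "int \<Rightarrow> 'a \<Rightarrow> complex"
  assumes [measurable]: "\<And>\<gamma>. u \<gamma> \<in> borel_measurable M"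
    and s: "\<And>x. (\<lambda>\<gamma>. u \<gamma> x) summable_on UNIV"
  shows "(\<lambda>x. \<Sum>\<^sub>\<infinity>\<gamma>\<in>UNIV. u \<gamma> x) \<in> borel_measurable M"
proof (rule borel_measurable_LIMSEQ_metric)
  show "(\<lambda>x. \<Sum>\<gamma>\<in>{- int n..int n}. u \<gamma> x) \<in> borel_measurable M" for n by measurable
  fix x
  have lim: "filterlim (\<lambda>n. {- int n..int n}) (finite_subsets_at_top UNIV) sequentially"
  proof (subst filterlim_finite_subsets_at_top, safe)
    fix Y :: "int set" assume Y: "finite Y"
    define m where "m = Max (insert 0 (abs ` Y))"
    have m: "\<bar>y\<bar> \<le> m" if "y \<in> Y" for y
      unfolding m_def using Y that by (intro Max_ge) auto
    show "\<forall>\<^sub>F n in sequentially. finite {- int n..int n} \<and> Y \<subseteq> {- int n..int n} \<and> {- int n..int n} \<subseteq> UNIV"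
      using eventually_ge_at_top[of "nat m"]
    proof eventually_elim
      case (elim n)
      then show ?case using m by fastforce
    qed
  qed
  show "(\<lambda>n. \<Sum>\<gamma>\<in>{- int n..int n}. u \<gamma> x) \<longlonglongrightarrow> (\<Sum>\<^sub>\<infinity>\<gamma>\<in>UNIV. u \<gamma> x)"
    using filterlim_compose[OF has_sum_infsum[OF s, unfolded has_sum_def] lim] by simp
qed

text \<open>A continuous function is bounded everywhere, not only almost everywhere, by its essential
  supremum, because nonempty open sets have positive measure.\<close>

lemma Lp_norm_infinity_schwartz:
  fixes f :: "'a::euclidean_space \<Rightarrow> complex"
  assumes f: "schwartz f"
  obtains m where "0 \<le> m" "Lp_norm lborel \<infinity> f = ennreal m" "\<And>x. norm (f x) \<le> m"
proof -
  note [measurable] = schwartz_measurable[OF f]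
  obtain C where C: "0 \<le> C" "\<And>x. norm (f x) \<le> C" using schwartz_bounded[OF f] by auto
  define S where "S = Lp_norm lborel \<infinity> f"
  have S_eq: "S = esssup lborel (\<lambda>x. ennreal (norm (f x)))" by (simp add: S_def Lp_norm_def)
  have "S \<le> ennreal C" unfolding S_eq using C by (intro esssup_I) (auto intro: ennreal_leI)
  then have S: "S = ennreal (enn2real S)" by (simp add: le_less_trans[OF _ ennreal_less_top] ennreal_enn2real)
  define m where "m = enn2real S"
  have m: "0 \<le> m" by (simp add: m_def)
  have "AE x in lborel. ennreal (norm (f x)) \<le> S" unfolding S_eq by (rule esssup_AE)
  then have ae: "AE x in lborel. norm (f x) \<le> m"
    by (subst (asm) S) (simp add: m_def[symmetric] m)
  define U where "U = {x. m < norm (f x)}"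
  have "open U" unfolding U_def
    by (intro open_Collect_less continuous_intros schwartz_continuous f)
  have "U \<in> null_sets lborel"
    using ae AE_iff_null_sets[of U lborel] unfolding U_def by (simp add: not_less)
  then have "negligible U"
    by (simp add: negligible_iff_null_sets null_sets_completionI)
  with \<open>open U\<close> have "U = {}" using open_not_negligible by blast
  then have "norm (f x) \<le> m" for x by (auto simp: U_def not_less)
  then show ?thesis using that[of m] m S by (simp add: S_def m_def)
qed

lemma Lp_norm_1:
  assumes [measurable]: "f \<in> borel_measurable M"
  shows "Lp_norm M 1 f = (\<integral>\<^sup>+x. ennreal (norm (f x)) \<partial>M)"
  by (auto simp: Lp_norm_def Let_def less_top[symmetric] ennreal_enn2real_if)

text \<open>As the Gaussian is at most \<open>1\<close>, its square is dominated by the Gaussian itself,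
  whose integral scales like \<open>l^d\<close>.\<close>

lemma Lp_norm_2_mult_gaussian_le:
  fixes f :: "'a::euclidean_space \<Rightarrow> complex"
  assumes [measurable]: "f \<in> borel_measurable borel" and m: "0 \<le> m" "\<And>x. norm (f x) \<le> m" and l: "0 < l"
  shows "Lp_norm lborel 2 (\<lambda>x. f x * complex_of_real (gaussian c l x))
    \<le> ennreal (m * sqrt (l ^ DIM('a) * gaussian_mass TYPE('a)))"
proof -
  let ?g = "\<lambda>x. f x * complex_of_real (gaussian c l x)"
  define V where "V = l ^ DIM('a) * gaussian_mass TYPE('a)"
  have V: "0 \<le> V" using l gaussian_mass_nonneg[where 'a='a] by (simp add: V_def)
  define I where "I = (\<integral>\<^sup>+x. ennreal (norm (?g x) powr enn2real 2) \<partial>lborel)"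
  have "I \<le> (\<integral>\<^sup>+x. ennreal (m\<^sup>2) * ennreal (gaussian c l x) \<partial>lborel)"
    unfolding I_def
  proof (rule nn_integral_mono)
    fix x
    have g: "0 < gaussian c l x" "gaussian c l x \<le> 1" by (auto simp: gaussian_pos gaussian_le_1)
    have "norm (?g x) powr enn2real 2 = (norm (f x) * gaussian c l x)\<^sup>2"
      using g by (simp add: norm_mult powr_numeral)
    also have "\<dots> = (norm (f x))\<^sup>2 * (gaussian c l x * gaussian c l x)"
      by (simp add: power2_eq_square mult_ac)
    also have "\<dots> \<le> m\<^sup>2 * (gaussian c l x * 1)"
      using g m by (intro mult_mono power_mono) auto
    finally show "ennreal (norm (?g x) powr enn2real 2) \<le> ennreal (m\<^sup>2) * ennreal (gaussian c l x)"
      by (simp add: ennreal_mult'[symmetric] ennreal_leI)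
  qed
  also have "\<dots> = ennreal (m\<^sup>2) * (\<integral>\<^sup>+x. ennreal (gaussian c l x) \<partial>lborel)"
    by (rule nn_integral_cmult) measurable
  also have "\<dots> = ennreal (m\<^sup>2 * V)" by (simp add: nn_integral_gaussian[OF l] V_def ennreal_mult'[symmetric])
  finally have I: "I \<le> ennreal (m\<^sup>2 * V)" .
  then have fin: "I \<noteq> \<infinity>" by (auto simp: top_unique)
  have "enn2real I \<le> m\<^sup>2 * V" using enn2real_mono[OF I] V by simp
  then have "enn2real I powr (1 / 2) \<le> (m\<^sup>2 * V) powr (1 / 2)" by (intro powr_mono2) auto
  also have "\<dots> = m * sqrt V" using m V by (simp add: powr_half_sqrt real_sqrt_mult)
  finally have "enn2real I powr (1 / 2) \<le> m * sqrt V" .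
  moreover have "Lp_norm lborel 2 ?g = ennreal (enn2real I powr (1 / 2))"
    using fin unfolding Lp_norm_def Let_def I_def by simp
  ultimately show ?thesis unfolding V_def by (simp add: ennreal_leI)
qed

lemma borel_measurable_bilinear_op:
  fixes f1 f2 :: "real^'n \<Rightarrow> complex"
  assumes K: "\<And>\<gamma>. localized_kernel B (2 powi \<gamma>) (2 powi (\<mu> + \<gamma>)) (kernel_piece \<Phi> \<Omega> \<mu> \<gamma>)"
    and B: "0 \<le> B" and f: "schwartz f1" "schwartz f2"
  shows "bilinear_op \<Phi> \<Omega> \<mu> f1 f2 \<in> borel_measurable borel"
proof -
  note [measurable] = schwartz_measurable[OF f(1)] schwartz_measurable[OF f(2)]
    localized_kernel_measurable[OF K]
  have diag: "(\<lambda>x::real^'n. (x, x)) \<in> borel_measurable borel"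
    by (intro borel_measurable_continuous_onI continuous_intros)
  have "(\<lambda>x. \<Sum>\<^sub>\<infinity>\<gamma>\<in>UNIV. convolution (tensor f1 f2) (kernel_piece \<Phi> \<Omega> \<mu> \<gamma>) (x, x)) \<in> borel_measurable borel"
  proof (rule borel_measurable_infsum_int)
    show "(\<lambda>x. convolution (tensor f1 f2) (kernel_piece \<Phi> \<Omega> \<mu> \<gamma>) (x, x)) \<in> borel_measurable borel" for \<gamma>
      by (rule measurable_compose[OF diag]) measurable
    show "(\<lambda>\<gamma>. convolution (tensor f1 f2) (kernel_piece \<Phi> \<Omega> \<mu> \<gamma>) (x, x)) summable_on UNIV" for x
      by (rule summable_multiscale_schwartz[OF K B f])
  qed
  then show ?thesis by (simp add: bilinear_op_eq_infsum[abs_def])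
qed

lemma norm_diff_corner_cube_le:
  fixes x c :: "real^'n"
  assumes "x \<in> cbox c (c + (\<chi> i. l))"
  shows "norm (x - c) \<le> real CARD('n) * l"
proof -
  have "norm (x - c) \<le> (\<Sum>i\<in>UNIV. \<bar>(x - c) $ i\<bar>)" by (rule norm_le_l1_cart)
  also have "\<dots> \<le> (\<Sum>i\<in>(UNIV :: 'n set). l)"
  proof (rule sum_mono)
    fix i
    have "c $ i \<le> x $ i \<and> x $ i \<le> c $ i + l" using assms by (simp add: mem_box_cart)
    then show "\<bar>(x - c) $ i\<bar> \<le> l" by simp
  qed
  finally show ?thesis by simp
qed

lemma emeasure_cube:
  fixes c :: "real^'n"
  assumes "0 < l"
  shows "emeasure lborel (cbox c (c + (\<chi> i. l))) = ennreal (l ^ CARD('n))"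
proof -
  have l: "(\<chi> i. l) \<bullet> b = l" if "b \<in> Basis" for b :: "real^'n"
    using that by (auto simp: Basis_vec_def inner_axis)
  have "emeasure lborel (cbox c (c + (\<chi> i. l))) = (\<Prod>b\<in>(Basis :: (real^'n) set). (c + (\<chi> i. l) - c) \<bullet> b)"
    by (rule emeasure_lborel_cbox) (use assms l in \<open>simp add: inner_add_left\<close>)
  also have "\<dots> = ennreal (\<Prod>b\<in>(Basis :: (real^'n) set). l)"
    by (intro arg_cong[where f=ennreal] prod.cong) (auto simp: l)
  finally show ?thesis by simp
qed

text \<open>The corner \<open>c\<close> of the cube serves as the centre. Both coordinates of \<open>(x, x)
  - (c, c)\<close> have norm at most \<open>n l\<close>, whence the value of \<open>R\<close>.\<close>

lemma bilinear_op_cube_approximation: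
  fixes f1 f2 :: "real^'n \<Rightarrow> complex" and c :: "real^'n"
  assumes K: "\<And>\<gamma>. localized_kernel B (2 powi \<gamma>) (2 powi (\<mu> + \<gamma>)) (kernel_piece \<Phi> \<Omega> \<mu> \<gamma>)"
    and B: "0 \<le> B" and \<mu>: "0 \<le> \<mu>" and f: "schwartz f1" "schwartz f2"
    and m: "\<And>x. norm (f1 x) \<le> m1" "\<And>x. norm (f2 x) \<le> m2" and l: "0 < l"
  defines "R \<equiv> 2 * real CARD('n)"
  obtains a where "\<And>x. x \<in> cbox c (c + (\<chi> i. l)) \<Longrightarrow>
    norm (bilinear_op \<Phi> \<Omega> \<mu> f1 f2 x - a)
      \<le> exp (R\<^sup>2) * norm (bilinear_op \<Phi> \<Omega> \<mu> (\<lambda>x. f1 x * complex_of_real (gaussian c l x))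
                                            (\<lambda>x. f2 x * complex_of_real (gaussian c l x)) x)
        + m1 * m2 * B * comparison_const TYPE((real^'n) \<times> (real^'n)) R * (of_int \<mu> + 3)"
proof -
  let ?K = "\<lambda>\<gamma>. kernel_piece \<Phi> \<Omega> \<mu> \<gamma>" and ?F = "tensor f1 f2" and ?E = "gaussian (c, c) l"
  let ?g1 = "\<lambda>x. f1 x * complex_of_real (gaussian c l x)" and ?g2 = "\<lambda>x. f2 x * complex_of_real (gaussian c l x)"
  let ?FE = "\<lambda>z. ?F z * complex_of_real (?E z)"
  obtain \<gamma>0 :: int where \<gamma>0: "1 \<le> l * 2 powi \<gamma>0" "l * 2 powi \<gamma>0 \<le> 2"
    using exists_dyadic_scale[OF l] by blast
  \<comment> \<open>The coarse scales, frozen at the corner: they sum to the constant subtracted on the cube.\<close>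
  define \<alpha> where "\<alpha> \<gamma> = (if \<gamma> - \<gamma>0 \<le> - \<mu> then convolution ?F (?K \<gamma>) (c, c) else 0)" for \<gamma>
  have F: "?F \<in> borel_measurable borel"
    by (intro borel_measurable_tensor schwartz_measurable f)
  have bd: "norm (?F z) \<le> m1 * m2" for z by (rule norm_tensor_le[OF m])
  have m0: "0 \<le> m1 * m2" using bd[of undefined] norm_ge_zero by (rule order_trans[rotated])
  have R: "0 \<le> R" by (simp add: R_def)
  have s: "(\<lambda>\<gamma>. convolution ?F (?K \<gamma>) p) summable_on UNIV" for p
    by (rule summable_multiscale_schwartz[OF K B f])
  have sE: "(\<lambda>\<gamma>. convolution ?FE (?K \<gamma>) p) summable_on UNIV" for p
    unfolding tensor_mult_gaussian[symmetric]
    by (rule summable_multiscale_schwartz[OF K B schwartz_mult_gaussian[OF f(1)] schwartz_mult_gaussian[OF f(2)]])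
  have s\<alpha>: "\<alpha> summable_on UNIV"
  proof -
    have "(\<lambda>\<gamma>. convolution ?F (?K \<gamma>) (c, c)) summable_on {\<gamma>. \<gamma> - \<gamma>0 \<le> - \<mu>}"
      by (rule summable_on_subset_banach[OF s]) simp
    then show ?thesis
      by (rule summable_on_cong_neutral[THEN iffD1, rotated -1]) (auto simp: \<alpha>_def)
  qed
  have "norm (bilinear_op \<Phi> \<Omega> \<mu> f1 f2 x - infsum \<alpha> UNIV)
      \<le> exp (R\<^sup>2) * norm (bilinear_op \<Phi> \<Omega> \<mu> ?g1 ?g2 x)
        + m1 * m2 * B * comparison_const TYPE((real^'n) \<times> (real^'n)) R * (of_int \<mu> + 3)"
    if x: "x \<in> cbox c (c + (\<chi> i. l))" for x
  proof -
    let ?p = "(x, x)"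
    let ?e = "complex_of_real (?E ?p)"
    define r where "r \<gamma> = convolution ?F (?K \<gamma>) ?p - convolution ?FE (?K \<gamma>) ?p / ?e - \<alpha> \<gamma>" for \<gamma>
    have "norm (?p - (c, c)) \<le> norm (x - c) + norm (x - c)"
      using norm_Pair_le[of "x - c" "x - c"] by simp
    then have p: "norm (?p - (c, c)) \<le> R * l"
      using norm_diff_corner_cube_le[OF x] by (simp add: R_def)
    have e: "exp (- R\<^sup>2) \<le> ?E ?p" by (rule gaussian_ge[OF l p])
    have r: "norm (r \<gamma>) \<le> m1 * m2 * B * comparison_const TYPE((real^'n) \<times> (real^'n)) R * scale_weight \<mu> (\<gamma> - \<gamma>0)" for \<gamma>
      unfolding r_def \<alpha>_def by (rule scale_comparison[OF K B \<mu> F bd l \<gamma>0 R p])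
    have "norm (infsum r UNIV) \<le> m1 * m2 * B * comparison_const TYPE((real^'n) \<times> (real^'n)) R * (of_int \<mu> + 3)"
      by (rule summable_scale_comparison(2)[OF \<mu> _ r])
         (intro mult_nonneg_nonneg m0 B comparison_const_nonneg R)
    moreover have r_sum: "infsum r UNIV = bilinear_op \<Phi> \<Omega> \<mu> f1 f2 x - bilinear_op \<Phi> \<Omega> \<mu> ?g1 ?g2 x / ?e - infsum \<alpha> UNIV"
    proof -
      have "((\<lambda>\<gamma>. convolution ?F (?K \<gamma>) ?p - convolution ?FE (?K \<gamma>) ?p / ?e - \<alpha> \<gamma>)
         has_sum (bilinear_op \<Phi> \<Omega> \<mu> f1 f2 x - bilinear_op \<Phi> \<Omega> \<mu> ?g1 ?g2 x / ?e - infsum \<alpha> UNIV)) UNIV"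
        unfolding bilinear_op_eq_infsum tensor_mult_gaussian diff_conv_add_uminus
        by (intro has_sum_add has_sum_uminusI has_sum_divide_const has_sum_infsum s sE s\<alpha>)
      then show ?thesis unfolding r_def by (rule infsumI)
    qed
    moreover have "norm (bilinear_op \<Phi> \<Omega> \<mu> ?g1 ?g2 x / ?e) \<le> exp (R\<^sup>2) * norm (bilinear_op \<Phi> \<Omega> \<mu> ?g1 ?g2 x)"
    proof -
      have "1 / ?E ?p \<le> exp (R\<^sup>2)"
        using e gaussian_pos[of "(c, c)" l ?p] by (simp add: exp_minus field_simps)
      then have "norm (bilinear_op \<Phi> \<Omega> \<mu> ?g1 ?g2 x) * (1 / ?E ?p) \<le> norm (bilinear_op \<Phi> \<Omega> \<mu> ?g1 ?g2 x) * exp (R\<^sup>2)"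
        by (intro mult_left_mono) auto
      then show ?thesis using gaussian_pos[of "(c, c)" l ?p] by (simp add: norm_divide mult.commute)
    qed
    moreover have "norm (bilinear_op \<Phi> \<Omega> \<mu> f1 f2 x - infsum \<alpha> UNIV)
        = norm (infsum r UNIV + bilinear_op \<Phi> \<Omega> \<mu> ?g1 ?g2 x / ?e)"
      unfolding r_sum by (rule arg_cong[where f=norm]) simp
    ultimately show ?thesis
      using norm_triangle_ineq[of "infsum r UNIV" "bilinear_op \<Phi> \<Omega> \<mu> ?g1 ?g2 x / ?e"]
      by linarith
  qed
  then show ?thesis using that by blast
qed

text \<open>Integrate the approximation over the cube. The product of the two \<open>L\<^sup>2\<close> norms
  with Gaussian cutoff is at most a multiple of \<open>l^n\<close>, which is the volume of the
  cube, so the average is bounded uniformly in \<open>l\<close>.\<close>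

lemma bilinear_op_BMO_le:
  fixes f1 f2 :: "real^'n \<Rightarrow> complex"
  assumes K: "\<And>\<gamma>. localized_kernel B (2 powi \<gamma>) (2 powi (\<mu> + \<gamma>)) (kernel_piece \<Phi> \<Omega> \<mu> \<gamma>)"
    and B: "0 \<le> B" and \<mu>: "0 \<le> \<mu>" and f: "schwartz f1" "schwartz f2"
    and m: "\<And>x. norm (f1 x) \<le> m1" "\<And>x. norm (f2 x) \<le> m2" "0 \<le> m1" "0 \<le> m2"
    and L1: "\<And>g1 g2. schwartz g1 \<Longrightarrow> schwartz g2 \<Longrightarrow>
       Lp_norm lborel 1 (bilinear_op \<Phi> \<Omega> \<mu> g1 g2) \<le> ennreal H * Lp_norm lborel 2 g1 * Lp_norm lborel 2 g2"
    and H: "0 \<le> H"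
  defines "R \<equiv> 2 * real CARD('n)"
  shows "BMO_norm (bilinear_op \<Phi> \<Omega> \<mu> f1 f2)
    \<le> ennreal ((exp (R\<^sup>2) * H * gaussian_mass TYPE(real^'n)
          + B * comparison_const TYPE((real^'n) \<times> (real^'n)) R * (of_int \<mu> + 3)) * (m1 * m2))"
    (is "_ \<le> ennreal ?bound")
  unfolding BMO_norm_def
proof (rule SUP_least)
  fix Q :: "(real^'n) set" assume "Q \<in> cubes"
  then obtain c l where Q: "Q = cbox c (c + (\<chi> i. l))" and l: "0 < l" by (auto simp: cubes_def)
  define D where "D = comparison_const TYPE((real^'n) \<times> (real^'n)) R"
  define W where "W = m1 * m2 * B * D * (of_int \<mu> + 3)"
  define G where "G = gaussian_mass TYPE(real^'n)"
  have G: "0 \<le> G" by (simp add: G_def gaussian_mass_nonneg)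
  have D: "0 \<le> D" unfolding D_def by (rule comparison_const_nonneg) (simp add: R_def)
  have W: "0 \<le> W" unfolding W_def using m B D \<mu> by simp
  let ?g1 = "\<lambda>x. f1 x * complex_of_real (gaussian c l x)" and ?g2 = "\<lambda>x. f2 x * complex_of_real (gaussian c l x)"
  let ?L = "bilinear_op \<Phi> \<Omega> \<mu> f1 f2" and ?L' = "bilinear_op \<Phi> \<Omega> \<mu> ?g1 ?g2"
  have g: "schwartz ?g1" "schwartz ?g2" by (intro schwartz_mult_gaussian f)+
  note [measurable] = borel_measurable_bilinear_op[OF K B g]
  obtain a where a: "\<And>x. x \<in> Q \<Longrightarrow> norm (?L x - a) \<le> exp (R\<^sup>2) * norm (?L' x) + W"
    using bilinear_op_cube_approximation[OF K B \<mu> f m(1,2) l, of c] unfolding Q W_def D_def R_def by blast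
  have [measurable]: "Q \<in> sets borel" by (simp add: Q)
  have vol: "emeasure lborel Q = ennreal (l ^ CARD('n))" unfolding Q by (rule emeasure_cube[OF l])
  have "(\<integral>\<^sup>+x\<in>Q. ennreal (norm (?L x - a)) \<partial>lborel)
      \<le> (\<integral>\<^sup>+x. ennreal (exp (R\<^sup>2)) * ennreal (norm (?L' x)) + ennreal W * indicator Q x \<partial>lborel)"
  proof (rule nn_integral_mono)
    fix x
    show "ennreal (norm (?L x - a)) * indicator Q x
        \<le> ennreal (exp (R\<^sup>2)) * ennreal (norm (?L' x)) + ennreal W * indicator Q x"
      using ennreal_leI[OF a[of x]] W by (auto simp: ennreal_mult' split: split_indicator)
  qed
  also have "\<dots> = ennreal (exp (R\<^sup>2)) * (\<integral>\<^sup>+x. ennreal (norm (?L' x)) \<partial>lborel) + ennreal W * emeasure lborel Q"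
    by (subst nn_integral_add) (auto simp: nn_integral_cmult nn_integral_cmult_indicator)
  also have "(\<integral>\<^sup>+x. ennreal (norm (?L' x)) \<partial>lborel) \<le> ennreal (H * (m1 * m2) * (l ^ CARD('n) * G))"
  proof -
    define v where "v = l ^ CARD('n) * G"
    have v: "0 \<le> v" using l G by (simp add: v_def)
    have n1: "Lp_norm lborel 2 ?g1 \<le> ennreal (m1 * sqrt v)"
      using Lp_norm_2_mult_gaussian_le[OF schwartz_measurable[OF f(1)] m(3,1) l, of c] by (simp add: v_def G_def)
    have n2: "Lp_norm lborel 2 ?g2 \<le> ennreal (m2 * sqrt v)"
      using Lp_norm_2_mult_gaussian_le[OF schwartz_measurable[OF f(2)] m(4,2) l, of c] by (simp add: v_def G_def)
    have "(\<integral>\<^sup>+x. ennreal (norm (?L' x)) \<partial>lborel) = Lp_norm lborel 1 ?L'"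
      by (rule Lp_norm_1[symmetric]) measurable
    also have "\<dots> \<le> ennreal H * Lp_norm lborel 2 ?g1 * Lp_norm lborel 2 ?g2" by (rule L1[OF g])
    also have "\<dots> \<le> ennreal H * ennreal (m1 * sqrt v) * ennreal (m2 * sqrt v)"
      by (intro mult_mono n1 n2) auto
    also have "\<dots> = ennreal (H * (m1 * sqrt v) * (m2 * sqrt v))"
      using H m v by (simp add: ennreal_mult'[symmetric])
    also have "H * (m1 * sqrt v) * (m2 * sqrt v) = H * (m1 * m2) * v"
    proof -
      have "H * (m1 * sqrt v) * (m2 * sqrt v) = H * (m1 * m2) * (sqrt v * sqrt v)"
        by (simp only: mult_ac)
      then show ?thesis using v by simp
    qed
    finally show ?thesis by (simp add: v_def)
  qed
  also have "ennreal (exp (R\<^sup>2)) * ennreal (H * (m1 * m2) * (l ^ CARD('n) * G)) + ennreal W * emeasure lborel Q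
      = ennreal (?bound * l ^ CARD('n))"
  proof -
    have "?bound * l ^ CARD('n) = exp (R\<^sup>2) * (H * (m1 * m2) * (l ^ CARD('n) * G)) + W * l ^ CARD('n)"
      by (simp add: W_def D_def G_def algebra_simps)
    then show ?thesis
      using H m l G W by (simp add: vol ennreal_mult'[symmetric] ennreal_plus[symmetric] del: ennreal_plus)
  qed
  finally have "(\<integral>\<^sup>+x\<in>Q. ennreal (norm (?L x - a)) \<partial>lborel) \<le> ennreal (?bound * l ^ CARD('n))"
    by (simp add: add_right_mono mult_left_mono)
  then have "(\<integral>\<^sup>+x\<in>Q. ennreal (norm (?L x - a)) \<partial>lborel) / emeasure lborel Q
      \<le> ennreal (?bound * l ^ CARD('n)) / ennreal (l ^ CARD('n))"
    unfolding vol by (rule divide_right_mono_ennreal)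
  also have "\<dots> = ennreal ?bound"
  proof (subst divide_ennreal)
    show "0 \<le> ?bound * l ^ CARD('n)"
      using H m l G[unfolded G_def] B D[unfolded D_def] \<mu> by simp
  qed (use l in auto)
  finally show "(INF a. (\<integral>\<^sup>+x\<in>Q. ennreal (norm (?L x - a)) \<partial>lborel) / emeasure lborel Q) \<le> ennreal ?bound"
    by (rule INF_lower2[OF UNIV_I])
qed

lemma linear_le_exponential:
  fixes \<delta> x :: real
  assumes "0 < \<delta>" "0 \<le> x"
  shows "x + 3 \<le> (3 + 1 / (\<delta> * ln 2)) * 2 powr (\<delta> * x)"
proof -
  let ?c = "\<delta> * ln 2"
  have c: "0 < ?c" using assms by simp
  have eq: "2 powr (\<delta> * x) = exp (?c * x)" by (simp add: powr_def mult_ac)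
  have ge: "1 + ?c * x \<le> exp (?c * x)" by (rule exp_ge_add_one_self)
  moreover have "0 \<le> ?c * x" using c assms by simp
  ultimately have 1: "1 \<le> exp (?c * x)" "?c * x \<le> exp (?c * x)" by linarith+
  then have "x \<le> exp (?c * x) / ?c" using c by (simp only: pos_le_divide_eq mult.commute)
  with 1 have "x + 3 \<le> exp (?c * x) / ?c + 3 * exp (?c * x)" by linarith
  then show ?thesis unfolding eq by (simp add: distrib_right add.commute)
qed

theorem proposition4p4:
  fixes \<Phi> :: "(real^'n) \<times> (real^'n) \<Rightarrow> complex"
    and q :: ennreal and \<delta> :: real and \<mu>0 :: int
  assumes \<Phi>_schwartz: "schwartz \<Phi>"
    and \<Phi>_supp: "closure {\<xi>. fourier \<Phi> \<xi> \<noteq> 0} \<subseteq> {\<xi>. 1/2 \<le> norm \<xi> \<and> norm \<xi> \<le> 2}"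
    and \<Phi>_partition: "\<And>\<xi>. \<xi> \<noteq> 0 \<Longrightarrow> ((\<lambda>j::int. fourier \<Phi> (\<xi> /\<^sub>R 2 powi j)) has_sum 1) UNIV"
    and q: "4/3 < q"
    and \<delta>: "0 < \<delta>"
    and \<mu>0_pos: "0 < \<mu>0"
    and \<mu>0_estimate:
      "\<exists>\<epsilon>1 C1 :: real. 0 < \<epsilon>1 \<and> 0 < C1 \<and>
         (\<forall>\<mu>\<ge>\<mu>0. \<forall>\<Omega>\<in>Lp_space sphere_measure q. (LINT \<theta>|sphere_measure. \<Omega> \<theta>) = 0 \<longrightarrow>
            (\<forall>f1 f2. schwartz f1 \<and> schwartz f2 \<longrightarrow>
               Lp_norm lborel 1 (bilinear_op \<Phi> \<Omega> \<mu> f1 f2)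
                 \<le> ennreal (C1 * 2 powr (- \<epsilon>1 * of_int \<mu>)) * Lp_norm sphere_measure q \<Omega>
                     * Lp_norm lborel 2 f1 * Lp_norm lborel 2 f2))"
  shows "\<exists>C::real. 0 < C \<and>
     (\<forall>\<mu>\<ge>\<mu>0. \<forall>\<Omega>\<in>Lp_space sphere_measure q. (LINT \<theta>|sphere_measure. \<Omega> \<theta>) = 0 \<longrightarrow>
        (\<forall>f1 f2. schwartz f1 \<and> schwartz f2 \<longrightarrow>
           BMO_norm (bilinear_op \<Phi> \<Omega> \<mu> f1 f2)
             \<le> ennreal (C * 2 powr (\<delta> * of_int \<mu>)) * Lp_norm sphere_measure q \<Omega>
                 * Lp_norm lborel \<infinity> f1 * Lp_norm lborel \<infinity> f2))"
proof -
  obtain \<epsilon>1 C1 :: real where \<epsilon>1: "0 < \<epsilon>1" and C1: "0 < C1"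
    and est: "\<forall>\<mu>\<ge>\<mu>0. \<forall>\<Omega>\<in>Lp_space sphere_measure q. (LINT \<theta>|sphere_measure. \<Omega> \<theta>) = 0 \<longrightarrow>
       (\<forall>f1 f2. schwartz f1 \<and> schwartz f2 \<longrightarrow>
          Lp_norm lborel 1 (bilinear_op \<Phi> \<Omega> \<mu> f1 f2)
            \<le> ennreal (C1 * 2 powr (- \<epsilon>1 * of_int \<mu>)) * Lp_norm sphere_measure q \<Omega>
                * Lp_norm lborel 2 f1 * Lp_norm lborel 2 f2)"
    using \<mu>0_estimate by (elim exE conjE) (rule that)
  have supp: "1/2 \<le> norm \<xi> \<and> norm \<xi> \<le> 2" if "fourier \<Phi> \<xi> \<noteq> 0" for \<xi>
  proof -
    have "\<xi> \<in> closure {\<xi>. fourier \<Phi> \<xi> \<noteq> 0}"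
      by (rule subsetD[OF closure_subset]) (use that in simp)
    with \<Phi>_supp have "\<xi> \<in> {\<xi>. 1/2 \<le> norm \<xi> \<and> norm \<xi> \<le> 2}" by (rule subsetD)
    then show ?thesis by simp
  qed
  have "ennreal 1 \<le> ennreal (4 / 3)" by (rule ennreal_leI) simp
  also have "\<dots> = ennreal 4 / ennreal 3" by (rule divide_ennreal[symmetric]) simp_all
  finally have "(1::ennreal) \<le> 4 / 3" by (simp only: ennreal_numeral ennreal_1)
  then have q1: "1 \<le> q" using q by simp
  obtain A where A: "0 < A"
    and K: "\<And>\<mu> \<gamma> \<Omega>. 0 \<le> \<mu> \<Longrightarrow> \<Omega> \<in> Lp_space sphere_measure q \<Longrightarrow>
       localized_kernel (A * enn2real (Lp_norm sphere_measure q \<Omega>))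
         (2 powi \<gamma>) (2 powi (\<mu> + \<gamma>)) (kernel_piece \<Phi> \<Omega> \<mu> \<gamma>)"
    by (rule kernel_piece_localized[OF \<Phi>_schwartz supp q1]) (assumption, rule that)
  define R where "R = 2 * real CARD('n)"
  define G where "G = gaussian_mass TYPE(real^'n)"
  define D where "D = comparison_const TYPE((real^'n) \<times> (real^'n)) R"
  have G: "0 \<le> G" by (simp add: G_def gaussian_mass_nonneg)
  have D: "0 \<le> D" unfolding D_def by (rule comparison_const_nonneg) (simp add: R_def)
  define c\<delta> where "c\<delta> = 3 + 1 / (\<delta> * ln 2)"
  have c\<delta>: "0 < c\<delta>" using \<delta> by (auto simp: c\<delta>_def intro!: add_pos_nonneg)
  \<comment> \<open>The summand \<open>1\<close> only serves to make the constant positive.\<close>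
  define C where "C = exp (R\<^sup>2) * C1 * G + A * D * c\<delta> + 1"
  show ?thesis
  proof (intro exI[of _ C] conjI allI ballI impI)
    have "0 \<le> exp (R\<^sup>2) * C1 * G" "0 \<le> A * D * c\<delta>" using C1 G A D c\<delta> by auto
    then show "0 < C" unfolding C_def by linarith
    fix \<mu> :: int and \<Omega> :: "(real^'n) \<times> (real^'n) \<Rightarrow> complex" and f1 f2 :: "real^'n \<Rightarrow> complex"
    assume \<mu>: "\<mu>0 \<le> \<mu>" and \<Omega>: "\<Omega> \<in> Lp_space sphere_measure q" "(LINT \<theta>|sphere_measure. \<Omega> \<theta>) = 0"
      and "schwartz f1 \<and> schwartz f2"
    then have f: "schwartz f1" "schwartz f2" by auto
    have \<mu>': "0 \<le> \<mu>" using \<mu> \<mu>0_pos by simp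
    define N where "N = enn2real (Lp_norm sphere_measure q \<Omega>)"
    have N: "0 \<le> N" and N_eq: "Lp_norm sphere_measure q \<Omega> = ennreal N"
      using \<Omega>(1) by (auto simp: N_def Lp_space_def)
    obtain m1 where m1: "0 \<le> m1" "Lp_norm lborel \<infinity> f1 = ennreal m1" "\<And>x. norm (f1 x) \<le> m1"
      using Lp_norm_infinity_schwartz[OF f(1)] by blast
    obtain m2 where m2: "0 \<le> m2" "Lp_norm lborel \<infinity> f2 = ennreal m2" "\<And>x. norm (f2 x) \<le> m2"
      using Lp_norm_infinity_schwartz[OF f(2)] by blast
    define H where "H = C1 * 2 powr (- \<epsilon>1 * of_int \<mu>) * N"
    define P where "P = 2 powr (\<delta> * of_int \<mu>)"
    have P: "1 \<le> P" unfolding P_def using \<delta> \<mu>' by (intro ge_one_powr_ge_zero) auto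
    have "BMO_norm (bilinear_op \<Phi> \<Omega> \<mu> f1 f2)
       \<le> ennreal ((exp (R\<^sup>2) * H * G + (A * N) * D * (of_int \<mu> + 3)) * (m1 * m2))"
      unfolding R_def G_def D_def
    proof (rule bilinear_op_BMO_le)
      show "localized_kernel (A * N) (2 powi \<gamma>) (2 powi (\<mu> + \<gamma>)) (kernel_piece \<Phi> \<Omega> \<mu> \<gamma>)" for \<gamma>
        unfolding N_def by (rule K[OF \<mu>' \<Omega>(1)])
      show "Lp_norm lborel 1 (bilinear_op \<Phi> \<Omega> \<mu> g1 g2) \<le> ennreal H * Lp_norm lborel 2 g1 * Lp_norm lborel 2 g2"
        if "schwartz g1" "schwartz g2" for g1 g2
        using est[rule_format, OF \<mu> \<Omega> conjI[OF that]] C1 N by (simp add: H_def N_eq ennreal_mult')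
      show "0 \<le> A * N" "0 \<le> H" using A N C1 by (simp_all add: H_def)
    qed (fact \<mu>' f m1 m2)+
    also have "\<dots> \<le> ennreal (C * P * N * m1 * m2)"
    proof (rule ennreal_leI)
      have "2 powr (- \<epsilon>1 * of_int \<mu>) \<le> 1"
        using \<epsilon>1 \<mu>' powr_mono[of "- \<epsilon>1 * of_int \<mu>" 0 2] by simp
      then have "H \<le> C1 * P * N"
        unfolding H_def using C1 N P by (intro mult_right_mono mult_left_mono) auto
      then have 1: "exp (R\<^sup>2) * H * G \<le> exp (R\<^sup>2) * (C1 * P * N) * G"
        using G by (intro mult_right_mono mult_left_mono) auto
      have "of_int \<mu> + 3 \<le> c\<delta> * P"
        unfolding c\<delta>_def P_def using linear_le_exponential[OF \<delta>, of "of_int \<mu>"] \<mu>' by simp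
      then have 2: "A * N * D * (of_int \<mu> + 3) \<le> A * N * D * (c\<delta> * P)"
        using A N D by (intro mult_left_mono) auto
      have "exp (R\<^sup>2) * H * G + A * N * D * (of_int \<mu> + 3) \<le> C * P * N"
      proof -
        have "exp (R\<^sup>2) * (C1 * P * N) * G + A * N * D * (c\<delta> * P) = (exp (R\<^sup>2) * C1 * G + A * D * c\<delta>) * (P * N)"
          by (simp add: algebra_simps)
        also have "\<dots> \<le> C * (P * N)"
          using P N by (intro mult_right_mono) (auto simp: C_def)
        finally show ?thesis using 1 2 unfolding mult.assoc[of C] by linarith
      qed
      then have "(exp (R\<^sup>2) * H * G + A * N * D * (of_int \<mu> + 3)) * (m1 * m2) \<le> C * P * N * (m1 * m2)"
        using m1 m2 by (intro mult_right_mono) auto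
      then show "(exp (R\<^sup>2) * H * G + A * N * D * (of_int \<mu> + 3)) * (m1 * m2) \<le> C * P * N * m1 * m2"
        by (simp add: mult.assoc)
    qed
    also have "\<dots> = ennreal (C * P) * Lp_norm sphere_measure q \<Omega> * Lp_norm lborel \<infinity> f1 * Lp_norm lborel \<infinity> f2"
      using \<open>0 < C\<close> P N m1 m2 by (simp add: N_eq ennreal_mult'[symmetric])
    finally show "BMO_norm (bilinear_op \<Phi> \<Omega> \<mu> f1 f2)
       \<le> ennreal (C * 2 powr (\<delta> * of_int \<mu>)) * Lp_norm sphere_measure q \<Omega>
          * Lp_norm lborel \<infinity> f1 * Lp_norm lborel \<infinity> f2"
      by (simp only: P_def)
  qed
qed

end
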